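(* There exists a consistent RE theory which has Turing degree $\mathbf{0}'$ but is not Creative.
   Context: Sentences are identified with Gödel numbers; for a theory $T$, $T_P=\{\ulcorner\phi\urcorner:T\vdash\phi\}$, and $T$ is Creative if $T_P$ is a creative set (an RE set whose complement is productive). The Turing degree of $T$ is that of $T_P$. *)

theory Defs
  imports Main "HOL-Library.Nat_Bijection"
begin

section \<open>Computability relative to an oracle\<close>

text \<open>
  Programs for the partial functions on the natural numbers that are partial recursive in a set.
  All functions are unary: several arguments are passed through the pairing bijection
  \<^const>\<open>prod_encode\<close>. \<open>Query\<close> is the characteristic function of the oracle,
  \<open>PRec\<close> is primitive recursion and \<open>Mu\<close> is unbounded minimisation.
\<close>

datatype prog =
    Zero
  | Succ
  | Left
  | Right
  | Query
  | Tuple prog prog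
  | Compose prog prog
  | PRec prog prog
  | Mu prog

inductive runs :: "nat set \<Rightarrow> prog \<Rightarrow> nat \<Rightarrow> nat \<Rightarrow> bool" for A :: "nat set" where
  Zero: "runs A Zero x 0"
| Succ: "runs A Succ x (Suc x)"
| Left: "runs A Left (prod_encode (a, b)) a"
| Right: "runs A Right (prod_encode (a, b)) b"
| Query: "runs A Query x (if x \<in> A then 1 else 0)"
| Tuple: "runs A p x y \<Longrightarrow> runs A q x z \<Longrightarrow> runs A (Tuple p q) x (prod_encode (y, z))"
| Compose: "runs A q x y \<Longrightarrow> runs A p y z \<Longrightarrow> runs A (Compose p q) x z"
| PRec_0: "runs A p a y \<Longrightarrow> runs A (PRec p q) (prod_encode (a, 0)) y"
| PRec_Suc: "runs A (PRec p q) (prod_encode (a, n)) y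
    \<Longrightarrow> runs A q (prod_encode (a, prod_encode (n, y))) z
    \<Longrightarrow> runs A (PRec p q) (prod_encode (a, Suc n)) z"
| Mu: "runs A p (prod_encode (x, n)) 0
    \<Longrightarrow> \<forall>m<n. \<exists>k. runs A p (prod_encode (x, m)) (Suc k)
    \<Longrightarrow> runs A (Mu p) x n"

primrec code_prog :: "prog \<Rightarrow> nat" where
  "code_prog Zero = prod_encode (0, 0)"
| "code_prog Succ = prod_encode (1, 0)"
| "code_prog Left = prod_encode (2, 0)"
| "code_prog Right = prod_encode (3, 0)"
| "code_prog Query = prod_encode (4, 0)"
| "code_prog (Tuple p q) = prod_encode (5, prod_encode (code_prog p, code_prog q))"
| "code_prog (Compose p q) = prod_encode (6, prod_encode (code_prog p, code_prog q))"
| "code_prog (PRec p q) = prod_encode (7, prod_encode (code_prog p, code_prog q))"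
| "code_prog (Mu p) = prod_encode (8, code_prog p)"

text \<open>
  The domain of the \<open>e\<close>-th function partial recursive in \<open>A\<close>. A number that is not the code of a
  program is an index of the nowhere defined function.
\<close>

definition W_rel :: "nat set \<Rightarrow> nat \<Rightarrow> nat set" where
  "W_rel A e = {x. \<exists>p y. code_prog p = e \<and> runs A p x y}"

text \<open>The unrelativised notions are those with the empty oracle.\<close>

abbreviation W :: "nat \<Rightarrow> nat set" where
  "W e \<equiv> W_rel {} e"

definition recursive_fun :: "(nat \<Rightarrow> nat) \<Rightarrow> bool" where
  "recursive_fun f \<longleftrightarrow> (\<exists>p. \<forall>x. runs {} p x (f x))"

definition re_set :: "nat set \<Rightarrow> bool" where
  "re_set A \<longleftrightarrow> (\<exists>e. A = W e)"

definition turing_le :: "nat set \<Rightarrow> nat set \<Rightarrow> bool" where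
  "turing_le A B \<longleftrightarrow> (\<exists>p. \<forall>x. runs B p x (if x \<in> A then 1 else 0))"

definition recursive_set :: "nat set \<Rightarrow> bool" where
  "recursive_set A \<longleftrightarrow> recursive_fun (\<lambda>x. if x \<in> A then 1 else 0)"

definition turing_degree :: "nat set \<Rightarrow> nat set set" where
  "turing_degree A = {B. turing_le A B \<and> turing_le B A}"

definition jump :: "nat set \<Rightarrow> nat set" where
  "jump A = {e. e \<in> W_rel A e}"

definition zero_jump :: "nat set set" where
  "zero_jump = turing_degree (jump {})"

definition productive :: "nat set \<Rightarrow> bool" where
  "productive A \<longleftrightarrow> (\<exists>f. recursive_fun f \<and> (\<forall>e. W e \<subseteq> A \<longrightarrow> f e \<in> A - W e))"

definition creative :: "nat set \<Rightarrow> bool" where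
  "creative A \<longleftrightarrow> re_set A \<and> productive (- A)"


section \<open>First-order logic with equality\<close>

text \<open>Bound variables are de Bruijn indices.\<close>

datatype tm = Var nat | Fn nat "tm list"

datatype fm =
    Falsum
  | Eq tm tm
  | Rel nat "tm list"
  | Imp fm fm
  | All fm

text \<open>
  The non-logical symbols are pairs of a name and an arity. Constants are function symbols of
  arity \<open>0\<close>.
\<close>

record language =
  funs :: "(nat \<times> nat) set"
  rels :: "(nat \<times> nat) set"

definition recursive_language :: "language \<Rightarrow> bool" where
  "recursive_language L \<longleftrightarrow>
     recursive_set (prod_encode ` funs L) \<and>
     recursive_set (prod_encode ` rels L) \<and>
     (\<forall>(r, k) \<in> rels L. k \<ge> 1)"

fun wf_tm :: "language \<Rightarrow> tm \<Rightarrow> bool" where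
  "wf_tm L (Var n) \<longleftrightarrow> True"
| "wf_tm L (Fn f ts) \<longleftrightarrow> (f, length ts) \<in> funs L \<and> (\<forall>t \<in> set ts. wf_tm L t)"

fun wf_fm :: "language \<Rightarrow> fm \<Rightarrow> bool" where
  "wf_fm L Falsum \<longleftrightarrow> True"
| "wf_fm L (Eq s t) \<longleftrightarrow> wf_tm L s \<and> wf_tm L t"
| "wf_fm L (Rel r ts) \<longleftrightarrow> (r, length ts) \<in> rels L \<and> (\<forall>t \<in> set ts. wf_tm L t)"
| "wf_fm L (Imp p q) \<longleftrightarrow> wf_fm L p \<and> wf_fm L q"
| "wf_fm L (All p) \<longleftrightarrow> wf_fm L p"

text \<open>All free variables have an index below \<open>n\<close>.\<close>

fun closed_tm :: "nat \<Rightarrow> tm \<Rightarrow> bool" where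
  "closed_tm n (Var i) \<longleftrightarrow> i < n"
| "closed_tm n (Fn f ts) \<longleftrightarrow> (\<forall>t \<in> set ts. closed_tm n t)"

fun closed_fm :: "nat \<Rightarrow> fm \<Rightarrow> bool" where
  "closed_fm n Falsum \<longleftrightarrow> True"
| "closed_fm n (Eq s t) \<longleftrightarrow> closed_tm n s \<and> closed_tm n t"
| "closed_fm n (Rel r ts) \<longleftrightarrow> (\<forall>t \<in> set ts. closed_tm n t)"
| "closed_fm n (Imp p q) \<longleftrightarrow> closed_fm n p \<and> closed_fm n q"
| "closed_fm n (All p) \<longleftrightarrow> closed_fm (Suc n) p"

definition sentence :: "language \<Rightarrow> fm \<Rightarrow> bool" where
  "sentence L p \<longleftrightarrow> wf_fm L p \<and> closed_fm 0 p"

fun subst_tm :: "(nat \<Rightarrow> tm) \<Rightarrow> tm \<Rightarrow> tm" where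
  "subst_tm \<sigma> (Var n) = \<sigma> n"
| "subst_tm \<sigma> (Fn f ts) = Fn f (map (subst_tm \<sigma>) ts)"

definition shift :: "nat \<Rightarrow> tm" where
  "shift n = Var (Suc n)"

definition under_binder :: "(nat \<Rightarrow> tm) \<Rightarrow> nat \<Rightarrow> tm" where
  "under_binder \<sigma> = case_nat (Var 0) (\<lambda>n. subst_tm shift (\<sigma> n))"

fun subst_fm :: "(nat \<Rightarrow> tm) \<Rightarrow> fm \<Rightarrow> fm" where
  "subst_fm \<sigma> Falsum = Falsum"
| "subst_fm \<sigma> (Eq s t) = Eq (subst_tm \<sigma> s) (subst_tm \<sigma> t)"
| "subst_fm \<sigma> (Rel r ts) = Rel r (map (subst_tm \<sigma>) ts)"
| "subst_fm \<sigma> (Imp p q) = Imp (subst_fm \<sigma> p) (subst_fm \<sigma> q)"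
| "subst_fm \<sigma> (All p) = All (subst_fm (under_binder \<sigma>) p)"

text \<open>Replaces variable \<open>0\<close> by \<open>t\<close> and lowers the other free variables by one.\<close>

definition inst :: "fm \<Rightarrow> tm \<Rightarrow> fm" where
  "inst p t = subst_fm (case_nat t Var) p"

text \<open>
  A Hilbert calculus. A theory is given by a set \<open>T\<close> of sentences, its axioms, so that
  the rule \<open>Gen\<close> needs no side condition.
\<close>

inductive proves :: "language \<Rightarrow> fm set \<Rightarrow> fm \<Rightarrow> bool" for L :: language and T :: "fm set" where
  Axiom: "p \<in> T \<Longrightarrow> proves L T p"
| K: "wf_fm L p \<Longrightarrow> wf_fm L q \<Longrightarrow> proves L T (Imp p (Imp q p))"
| S: "wf_fm L p \<Longrightarrow> wf_fm L q \<Longrightarrow> wf_fm L r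
    \<Longrightarrow> proves L T (Imp (Imp p (Imp q r)) (Imp (Imp p q) (Imp p r)))"
| DNeg: "wf_fm L p \<Longrightarrow> proves L T (Imp (Imp (Imp p Falsum) Falsum) p)"
| Inst: "wf_fm L p \<Longrightarrow> wf_tm L t \<Longrightarrow> proves L T (Imp (All p) (inst p t))"
| Distr: "wf_fm L p \<Longrightarrow> wf_fm L q
    \<Longrightarrow> proves L T (Imp (All (Imp (subst_fm shift p) q)) (Imp p (All q)))"
| Refl: "wf_tm L t \<Longrightarrow> proves L T (Eq t t)"
| Leibniz: "wf_fm L p \<Longrightarrow> wf_tm L s \<Longrightarrow> wf_tm L t
    \<Longrightarrow> proves L T (Imp (Eq s t) (Imp (inst p s) (inst p t)))"
| MP: "proves L T (Imp p q) \<Longrightarrow> proves L T p \<Longrightarrow> proves L T q"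
| Gen: "proves L T p \<Longrightarrow> proves L T (All p)"


section \<open>Goedel numbers and theories\<close>

fun code_tm :: "tm \<Rightarrow> nat" where
  "code_tm (Var n) = prod_encode (0, n)"
| "code_tm (Fn f ts) = prod_encode (1, prod_encode (f, list_encode (map code_tm ts)))"

fun code_fm :: "fm \<Rightarrow> nat" where
  "code_fm Falsum = prod_encode (0, 0)"
| "code_fm (Eq s t) = prod_encode (1, prod_encode (code_tm s, code_tm t))"
| "code_fm (Rel r ts) = prod_encode (2, prod_encode (r, list_encode (map code_tm ts)))"
| "code_fm (Imp p q) = prod_encode (3, prod_encode (code_fm p, code_fm q))"
| "code_fm (All p) = prod_encode (4, code_fm p)"

definition is_theory :: "language \<Rightarrow> fm set \<Rightarrow> bool" where
  "is_theory L T \<longleftrightarrow> recursive_language L \<and> (\<forall>p \<in> T. sentence L p)"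

definition re_theory :: "language \<Rightarrow> fm set \<Rightarrow> bool" where
  "re_theory L T \<longleftrightarrow> is_theory L T \<and> re_set (code_fm ` T)"

definition consistent :: "language \<Rightarrow> fm set \<Rightarrow> bool" where
  "consistent L T \<longleftrightarrow> \<not> proves L T Falsum"

definition provable_codes :: "language \<Rightarrow> fm set \<Rightarrow> nat set" where
  "provable_codes L T = code_fm ` {p. sentence L p \<and> proves L T p}"

definition theory_degree :: "language \<Rightarrow> fm set \<Rightarrow> nat set set" where
  "theory_degree L T = turing_degree (provable_codes L T)"

definition creative_theory :: "language \<Rightarrow> fm set \<Rightarrow> bool" where
  "creative_theory L T \<longleftrightarrow> creative (provable_codes L T)"

end

theory Submission imports Defs begin

text \<open>
  Let \<open>f\<close> be an injective recursive function whose range has degree \<open>0'\<close>. A stage \<open>i\<close> is true if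
  \<open>f i \<le> f s\<close> for all \<open>s > i\<close>; the set of the other stages is Dekker's hypersimple deficiency set of
  the range. In the language of infinitely many unary predicates, consider the one-point models
  \<open>M\<^sub>k\<close> in which exactly the \<open>k\<close>-th predicate fails, and let \<open>T\<close> be the set of all sentences that
  hold in \<open>M\<^sub>k\<close> for every true stage \<open>k\<close>. By soundness \<open>T\<close> is closed under deduction, so that
  nothing has to be known about the calculus beyond soundness. \<open>T\<close> is recursively enumerable
  because the set of stages that are not true is, and the sentence saying that the \<open>k\<close>-th predicate holds
  belongs to \<open>T\<close> iff \<open>k\<close> is not true, so that \<open>T\<close> computes the true stages and hence the range.
  A productive function for the complement of \<open>T\<close> would bound the next true stage recursively, and
  the range of \<open>f\<close> would be recursive.
\<close>

section \<open>Functions recursive in an oracle\<close>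

definition pfst :: "nat \<Rightarrow> nat" where
  "pfst z = fst (prod_decode z)"

definition psnd :: "nat \<Rightarrow> nat" where
  "psnd z = snd (prod_decode z)"

lemma pfst_prod_encode [simp]: "pfst (prod_encode (a, b)) = a"
  by (simp add: pfst_def)

lemma psnd_prod_encode [simp]: "psnd (prod_encode (a, b)) = b"
  by (simp add: psnd_def)

lemma prod_encode_pfst_psnd [simp]: "prod_encode (pfst z, psnd z) = z"
  by (simp add: pfst_def psnd_def)

lemma pfst_le: "pfst z \<le> z"
  by (metis le_prod_encode_1 prod_encode_pfst_psnd)

lemma psnd_le: "psnd z \<le> z"
  by (metis le_prod_encode_2 prod_encode_pfst_psnd)

section \<open>Determinism of evaluation and relative computability\<close>

inductive_cases runs_ZeroE: "runs A Zero x y"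
inductive_cases runs_SuccE: "runs A Succ x y"
inductive_cases runs_LeftE: "runs A Left x y"
inductive_cases runs_RightE: "runs A Right x y"
inductive_cases runs_QueryE: "runs A Query x y"
inductive_cases runs_TupleE: "runs A (Tuple p q) x y"
inductive_cases runs_ComposeE: "runs A (Compose p q) x y"
inductive_cases runs_PRecE: "runs A (PRec p q) x y"
inductive_cases runs_MuE: "runs A (Mu p) x y"

lemma runs_deterministic: "runs A p x y \<Longrightarrow> runs A p x z \<Longrightarrow> y = z"
proof (induction arbitrary: z rule: runs.induct)
  case (Tuple p x y q w)
  from Tuple.prems show ?case by (rule runs_TupleE) (use Tuple.IH in blast)
next
  case (Compose q x y p w)
  from Compose.prems show ?case by (rule runs_ComposeE) (use Compose.IH in blast)
next
  case (PRec_0 p a y q)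
  from PRec_0.prems show ?case by (rule runs_PRecE) (use PRec_0.IH in auto)
next
  case (PRec_Suc p q a n y w)
  from PRec_Suc.prems show ?case by (rule runs_PRecE) (use PRec_Suc.IH in auto)
next
  case (Mu p x n)
  from Mu.prems obtain pz: "runs A p (prod_encode (x, z)) 0"
    and lz: "\<forall>m<z. \<exists>k. runs A p (prod_encode (x, m)) (Suc k)"
    by (rule runs_MuE) auto
  \<comment> \<open>Two candidate zeros are compared: below the larger one every value is a
    successor, while the smaller one has value 0, and the induction hypothesis makes these values
    equal.\<close>
  have "\<not> z < n" using Mu.IH pz by fastforce
  moreover have "\<not> n < z" using Mu.IH lz by fastforce
  ultimately show ?case by simp
qed (auto elim: runs_ZeroE runs_SuccE runs_LeftE runs_RightE runs_QueryE)

definition rec_in :: "nat set \<Rightarrow> (nat \<Rightarrow> nat) \<Rightarrow> bool" where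
  "rec_in A f \<longleftrightarrow> (\<exists>p. \<forall>x. runs A p x (f x))"

definition dec_in :: "nat set \<Rightarrow> (nat \<Rightarrow> bool) \<Rightarrow> bool" where
  "dec_in A P \<longleftrightarrow> rec_in A (\<lambda>x. if P x then 1 else 0)"

lemma recursive_fun_iff: "recursive_fun f \<longleftrightarrow> rec_in {} f"
  by (simp add: recursive_fun_def rec_in_def)

lemma turing_le_iff: "turing_le A B \<longleftrightarrow> dec_in B (\<lambda>x. x \<in> A)"
  by (simp add: turing_le_def dec_in_def rec_in_def)

text \<open>Substituting a decision procedure for \<open>Query\<close> turns an oracle computation
  into one with another oracle; this is the source of the transitivity of Turing
  reducibility.\<close>

primrec query_replace :: "prog \<Rightarrow> prog \<Rightarrow> prog" where
  "query_replace r Zero = Zero"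
| "query_replace r Succ = Succ"
| "query_replace r Left = Left"
| "query_replace r Right = Right"
| "query_replace r Query = r"
| "query_replace r (Tuple p q) = Tuple (query_replace r p) (query_replace r q)"
| "query_replace r (Compose p q) = Compose (query_replace r p) (query_replace r q)"
| "query_replace r (PRec p q) = PRec (query_replace r p) (query_replace r q)"
| "query_replace r (Mu p) = Mu (query_replace r p)"

lemma runs_query_replace:
  assumes "\<And>x. runs B r x (if x \<in> A then 1 else 0)" and "runs A p x y"
  shows "runs B (query_replace r p) x y"
  using assms(2)
proof (induction rule: runs.induct)
  case (Query x)
  then show ?case using assms(1) by simp
qed (auto intro: runs.intros)

lemma rec_in_trans: "rec_in A f \<Longrightarrow> dec_in B (\<lambda>x. x \<in> A) \<Longrightarrow> rec_in B f"
  unfolding rec_in_def dec_in_def by (meson runs_query_replace)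

lemma turing_le_trans: "turing_le A B \<Longrightarrow> turing_le B C \<Longrightarrow> turing_le A C"
  unfolding turing_le_iff dec_in_def [of _ "\<lambda>x. x \<in> A"] by (rule rec_in_trans)

lemma turing_degree_eqI: "turing_le A B \<Longrightarrow> turing_le B A \<Longrightarrow> turing_degree A = turing_degree B"
  unfolding turing_degree_def by (blast intro: turing_le_trans)

section \<open>Closure properties of recursive functions and decidable predicates\<close>

named_theorems rec_intros

lemma rec_in_id [rec_intros]: "rec_in A (\<lambda>x. x)"
  unfolding rec_in_def
proof (intro exI allI)
  fix x
  show "runs A (Tuple Left Right) x x"
    using runs.Tuple[OF runs.Left runs.Right, of A "pfst x" "psnd x"] by simp
qed

lemma rec_in_const [rec_intros]: "rec_in A (\<lambda>x. c)"
proof (induction c)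
  case 0
  show ?case unfolding rec_in_def by (blast intro: runs.Zero)
next
  case (Suc c)
  then show ?case unfolding rec_in_def by (blast intro: runs.Compose runs.Succ)
qed

lemma rec_in_comp: "rec_in A f \<Longrightarrow> rec_in A g \<Longrightarrow> rec_in A (\<lambda>x. f (g x))"
  unfolding rec_in_def by (blast intro: runs.Compose)

lemma rec_in_pair [rec_intros]:
  "rec_in A f \<Longrightarrow> rec_in A g \<Longrightarrow> rec_in A (\<lambda>x. prod_encode (f x, g x))"
  unfolding rec_in_def by (blast intro: runs.Tuple)

lemma rec_in_Suc [rec_intros]: "rec_in A f \<Longrightarrow> rec_in A (\<lambda>x. Suc (f x))"
  unfolding rec_in_def by (blast intro: runs.Compose runs.Succ)

lemma runs_pfst: "runs A Left z (pfst z)"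
  using runs.Left[of A "pfst z" "psnd z"] by simp

lemma runs_psnd: "runs A Right z (psnd z)"
  using runs.Right[of A "pfst z" "psnd z"] by simp

lemma rec_in_pfst [rec_intros]: "rec_in A f \<Longrightarrow> rec_in A (\<lambda>x. pfst (f x))"
  unfolding rec_in_def using runs.Compose[OF _ runs_pfst] by blast

lemma rec_in_psnd [rec_intros]: "rec_in A f \<Longrightarrow> rec_in A (\<lambda>x. psnd (f x))"
  unfolding rec_in_def using runs.Compose[OF _ runs_psnd] by blast

text \<open>\<open>PRec\<close> hands its step the parameter, the index and the previous value as
  nested pairs, hence the projections in the assumption on \<open>g\<close>. The whole input
  \<open>x\<close> serves as the parameter, so start value, step and length may all depend on
  it.\<close>

lemma rec_in_rec_nat [rec_intros]:
  assumes f: "rec_in A f"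
    and g: "rec_in A (\<lambda>z. g (pfst z) (pfst (psnd z)) (psnd (psnd z)))"
    and n: "rec_in A n"
  shows "rec_in A (\<lambda>x. rec_nat (f x) (g x) (n x))"
proof -
  obtain p q where p: "\<And>x. runs A p x (f x)"
    and q: "\<And>z. runs A q z (g (pfst z) (pfst (psnd z)) (psnd (psnd z)))"
    using f g unfolding rec_in_def by blast
  have "runs A (PRec p q) (prod_encode (x, m)) (rec_nat (f x) (g x) m)" for x m
  proof (induction m)
    case 0
    show ?case using p by (simp add: PRec_0)
  next
    case (Suc m)
    show ?case
      using PRec_Suc[OF Suc, of "rec_nat (f x) (g x) (Suc m)"]
        q[of "prod_encode (x, prod_encode (m, rec_nat (f x) (g x) m))"] by simp
  qed
  then have "rec_in A (\<lambda>z. rec_nat (f (pfst z)) (g (pfst z)) (psnd z))"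
    unfolding rec_in_def by (metis prod_encode_pfst_psnd)
  from rec_in_comp[OF this rec_in_pair[OF rec_in_id n]] show ?thesis by simp
qed

lemma rec_in_add [rec_intros]:
  assumes "rec_in A f" "rec_in A g" shows "rec_in A (\<lambda>x. f x + g x)"
proof -
  have "a + b = rec_nat a (\<lambda>_. Suc) b" for a b by (induction b) auto
  moreover have "rec_in A (\<lambda>x. rec_nat (f x) (\<lambda>_. Suc) (g x))"
    by (intro rec_intros assms)
  ultimately show ?thesis by simp
qed

lemma rec_in_diff [rec_intros]:
  assumes "rec_in A f" "rec_in A g" shows "rec_in A (\<lambda>x. f x - g x)"
proof -
  \<comment> \<open>The predecessor is the recursion that returns its index; truncated subtraction
    iterates it.\<close>
  have eq1: "n - Suc 0 = rec_nat 0 (\<lambda>m _. m) n" for n by (cases n) auto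
  have eq2: "a - b = rec_nat a (\<lambda>_ y. rec_nat 0 (\<lambda>m _. m) y) b" for a b
    by (induction b) (auto simp flip: eq1)
  have "rec_in A (\<lambda>x. rec_nat (f x) (\<lambda>_ y. rec_nat 0 (\<lambda>m _. m) y) (g x))"
    by (intro rec_intros assms)
  then show ?thesis by (simp add: eq2)
qed

lemma rec_in_if [rec_intros]:
  assumes "dec_in A P" "rec_in A f" "rec_in A g"
  shows "rec_in A (\<lambda>x. if P x then f x else g x)"
proof -
  have "(if P x then f x else g x) = rec_nat (g x) (\<lambda>_ _. f x) (if P x then 1 else 0)" for x
    by simp
  moreover have "rec_in A (\<lambda>x. rec_nat (g x) (\<lambda>_ _. f x) (if P x then 1 else 0))"
    by (rule rec_in_rec_nat) (intro rec_intros assms rec_in_comp[OF assms(2)] assms[unfolded dec_in_def])+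
  ultimately show ?thesis by simp
qed

lemma dec_in_const [rec_intros]: "dec_in A (\<lambda>x. b)"
  unfolding dec_in_def by (rule rec_in_const)

lemma dec_in_comp: "dec_in A P \<Longrightarrow> rec_in A g \<Longrightarrow> dec_in A (\<lambda>x. P (g x))"
  unfolding dec_in_def by (rule rec_in_comp)

lemma dec_in_if:
  assumes "dec_in A P" "dec_in A Q" "dec_in A R"
  shows "dec_in A (\<lambda>x. if P x then Q x else R x)"
proof -
  have "rec_in A (\<lambda>x. if P x then if Q x then 1 else 0 else if R x then 1 else 0)"
    using assms unfolding dec_in_def by (intro rec_in_if) (simp_all add: dec_in_def rec_in_const)
  moreover have "(if P x then if Q x then 1 else 0 else if R x then 1 else 0)
      = (if (if P x then Q x else R x) then 1 else (0::nat))" for x by simp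
  ultimately show ?thesis unfolding dec_in_def by simp
qed

lemma dec_in_not [rec_intros]: "dec_in A P \<Longrightarrow> dec_in A (\<lambda>x. \<not> P x)"
  using dec_in_if[of A P "\<lambda>_. False" "\<lambda>_. True"] by (simp add: dec_in_const if_bool_eq_conj)

lemma dec_in_conj [rec_intros]: "dec_in A P \<Longrightarrow> dec_in A Q \<Longrightarrow> dec_in A (\<lambda>x. P x \<and> Q x)"
  using dec_in_if[of A P Q "\<lambda>_. False"] by (simp add: dec_in_const if_bool_eq_disj)

lemma dec_in_imp [rec_intros]: "dec_in A P \<Longrightarrow> dec_in A Q \<Longrightarrow> dec_in A (\<lambda>x. P x \<longrightarrow> Q x)"
  using dec_in_if[of A P Q "\<lambda>_. True"] by (simp add: dec_in_const if_bool_eq_conj)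

lemma dec_in_disj [rec_intros]: "dec_in A P \<Longrightarrow> dec_in A Q \<Longrightarrow> dec_in A (\<lambda>x. P x \<or> Q x)"
  unfolding disj_imp by (intro rec_intros)

lemma dec_in_less [rec_intros]:
  assumes "rec_in A f" "rec_in A g" shows "dec_in A (\<lambda>x. f x < g x)"
proof -
  \<comment> \<open>Double truncated subtraction from 1 is the sign function.\<close>
  have "rec_in A (\<lambda>x. 1 - (1 - (g x - f x)))" by (intro rec_intros assms)
  moreover have "1 - (1 - (g x - f x)) = (if f x < g x then 1 else 0)" for x by auto
  ultimately show ?thesis unfolding dec_in_def by simp
qed

lemma dec_in_le [rec_intros]:
  "rec_in A f \<Longrightarrow> rec_in A g \<Longrightarrow> dec_in A (\<lambda>x. f x \<le> g x)"
  unfolding not_less[symmetric] by (intro rec_intros)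

lemma dec_in_eq [rec_intros]:
  "rec_in A f \<Longrightarrow> rec_in A g \<Longrightarrow> dec_in A (\<lambda>x. f x = g x)"
  unfolding eq_iff by (intro rec_intros)

lemma dec_in_all_less [rec_intros]:
  assumes "dec_in A (\<lambda>z. P (pfst z) (psnd z))" "rec_in A n"
  shows "dec_in A (\<lambda>x. \<forall>k<n x. P x k)"
proof -
  let ?g = "\<lambda>x k y. if P x k then y else (0::nat)"
  have "rec_in A (\<lambda>x. rec_nat 1 (?g x) (n x))"
    using dec_in_comp[OF assms(1), of "\<lambda>z. prod_encode (pfst z, pfst (psnd z))"]
    by (intro rec_intros assms) (simp_all add: rec_intros)
  moreover have "rec_nat 1 (?g x) m = (if \<forall>k<m. P x k then 1 else 0)" for x m
    by (induction m) (auto simp: less_Suc_eq)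
  ultimately show ?thesis unfolding dec_in_def by simp
qed

lemma dec_in_ex_less [rec_intros]:
  assumes "dec_in A (\<lambda>z. P (pfst z) (psnd z))" "rec_in A n"
  shows "dec_in A (\<lambda>x. \<exists>k<n x. P x k)"
proof -
  have "dec_in A (\<lambda>x. \<not> (\<forall>k<n x. \<not> P x k))" by (intro rec_intros assms)
  then show ?thesis by simp
qed

lemma dec_in_all_le [rec_intros]:
  "dec_in A (\<lambda>z. P (pfst z) (psnd z)) \<Longrightarrow> rec_in A n \<Longrightarrow> dec_in A (\<lambda>x. \<forall>k\<le>n x. P x k)"
  unfolding less_Suc_eq_le[symmetric] by (intro rec_intros)

lemma dec_in_ex_le [rec_intros]:
  "dec_in A (\<lambda>z. P (pfst z) (psnd z)) \<Longrightarrow> rec_in A n \<Longrightarrow> dec_in A (\<lambda>x. \<exists>k\<le>n x. P x k)"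
  unfolding less_Suc_eq_le[symmetric] by (intro rec_intros)

lemma rec_in_funpow [rec_intros]:
  assumes "rec_in A (\<lambda>z. f (pfst z) (psnd z))" "rec_in A n" "rec_in A g"
  shows "rec_in A (\<lambda>x. (f x ^^ n x) (g x))"
proof -
  have "(f x ^^ m) a = rec_nat a (\<lambda>_. f x) m" for x m a by (induction m) auto
  moreover have "rec_in A (\<lambda>x. rec_nat (g x) (\<lambda>_. f x) (n x))"
    using rec_in_comp[OF assms(1), of "\<lambda>z. prod_encode (pfst z, psnd (psnd z))"]
    by (intro rec_intros assms) (simp_all add: rec_intros)
  ultimately show ?thesis by simp
qed

lemma rec_in_sum_le [rec_intros]:
  assumes "rec_in A (\<lambda>z. f (pfst z) (psnd z))" "rec_in A n"
  shows "rec_in A (\<lambda>x. \<Sum>k\<le>n x. f x k)"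
proof -
  have "(\<Sum>k<m. f x k) = rec_nat 0 (\<lambda>k y. y + f x k) m" for x m by (induction m) auto
  moreover have "rec_in A (\<lambda>x. rec_nat 0 (\<lambda>k y. y + f x k) (Suc (n x)))"
    using rec_in_comp[OF assms(1), of "\<lambda>z. prod_encode (pfst z, pfst (psnd z))"]
    by (intro rec_intros assms) (simp_all add: rec_intros)
  ultimately show ?thesis by (simp add: lessThan_Suc_atMost[symmetric])
qed

section \<open>Unbounded search and domains\<close>

lemma runs_MuI:
  assumes p: "\<And>z. runs A p z (if P (pfst z) (psnd z) then 0 else 1)" and n: "P x n"
  shows "runs A (Mu p) x (LEAST n. P x n)"
proof (rule runs.Mu)
  show "runs A p (prod_encode (x, LEAST n. P x n)) 0"
    using p[of "prod_encode (x, LEAST n. P x n)"] LeastI[of "P x", OF n] by simp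
  show "\<forall>m<LEAST n. P x n. \<exists>k. runs A p (prod_encode (x, m)) (Suc k)"
  proof (intro allI impI)
    fix m assume "m < (LEAST n. P x n)"
    then have "\<not> P x m" by (rule not_less_Least)
    then show "\<exists>k. runs A p (prod_encode (x, m)) (Suc k)"
      using p[of "prod_encode (x, m)"] by auto
  qed
qed

lemma rec_in_Least:
  assumes P: "dec_in A (\<lambda>z. P (pfst z) (psnd z))" and ex: "\<And>x. \<exists>n. P x n"
  shows "rec_in A (\<lambda>x. LEAST n. P x n)"
proof -
  have "rec_in A (\<lambda>z. if P (pfst z) (psnd z) then 0 else 1)" by (intro rec_intros P)
  then obtain p where p: "\<And>z. runs A p z (if P (pfst z) (psnd z) then 0 else 1)"
    unfolding rec_in_def by blast
  have "runs A (Mu p) x (LEAST n. P x n)" for x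
    using ex runs_MuI[of A p P, OF p] by blast
  then show ?thesis unfolding rec_in_def by blast
qed

text \<open>Existential projections of decidable relations are domains of programs: minimisation
  looks for a witness. Success is coded by 0, since \<open>Mu\<close> searches for a zero;
  determinism shows that halting implies a witness.\<close>

lemma domain_search:
  assumes "dec_in A (\<lambda>z. P (pfst z) (psnd z))"
  obtains p where "\<And>x. (\<exists>y. runs A p x y) \<longleftrightarrow> (\<exists>n. P x n)"
proof -
  have "rec_in A (\<lambda>z. if P (pfst z) (psnd z) then 0 else 1)" by (intro rec_intros assms)
  then obtain p where p: "\<And>z. runs A p z (if P (pfst z) (psnd z) then 0 else 1)"
    unfolding rec_in_def by blast
  have "(\<exists>y. runs A (Mu p) x y) \<longleftrightarrow> (\<exists>n. P x n)" for x
  proof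
    assume "\<exists>y. runs A (Mu p) x y"
    then obtain n where "runs A p (prod_encode (x, n)) 0" by (blast elim: runs_MuE)
    with p[of "prod_encode (x, n)"] have "P x n"
      by (auto dest: runs_deterministic split: if_splits)
    then show "\<exists>n. P x n" ..
  qed (use runs_MuI[of A p P, OF p] in blast)
  with that show thesis by blast
qed

lemma rec_in_of_empty: "rec_in {} f \<Longrightarrow> rec_in A f"
  by (erule rec_in_trans) (simp add: dec_in_const)

section \<open>Recursion on codes of trees\<close>

text \<open>A positive tag makes the pairing strictly larger than its second component, which is
  what recursion on codes rests on. Tag 0 is different:
  \<open>prod_encode (0, 0) = 0\<close>.\<close>

lemma child_less: "0 < m \<Longrightarrow> n < prod_encode (m, n)"
  unfolding prod_encode_def triangle_def by (cases m) (auto simp: algebra_simps)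

lemma psnd_less: "0 < pfst c \<Longrightarrow> psnd c < c"
  by (metis child_less prod_encode_pfst_psnd)

text \<open>
  The guards are needed for termination only: they hold whenever \<open>pfst c > 0\<close>.
\<close>

function tree_rec :: "(nat \<Rightarrow> nat \<Rightarrow> nat \<Rightarrow> nat \<Rightarrow> nat \<Rightarrow> nat) \<Rightarrow> nat \<Rightarrow> nat \<Rightarrow> nat" where
  "tree_rec h x c = h x c
     (if psnd c < c then tree_rec h x (psnd c) else 0)
     (if pfst (psnd c) < c then tree_rec h x (pfst (psnd c)) else 0)
     (if psnd (psnd c) < c then tree_rec h x (psnd (psnd c)) else 0)"
  by auto
termination by (relation "measure (\<lambda>(h, x, c). c)") auto

declare tree_rec.simps [simp del]

lemma tree_rec_node:
  assumes "0 < pfst c"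
  shows "tree_rec h x c = h x c (tree_rec h x (psnd c))
    (tree_rec h x (pfst (psnd c))) (tree_rec h x (psnd (psnd c)))"
  using psnd_less[OF assms] le_less_trans[OF pfst_le psnd_less[OF assms]]
    le_less_trans[OF psnd_le psnd_less[OF assms]]
  by (subst tree_rec.simps) simp

text \<open>Course-of-values recursion becomes primitive recursion by carrying all earlier values
  along as nested pairs.\<close>

lemma rec_in_tree_rec:
  assumes h: "rec_in A (\<lambda>z. h (pfst z) (pfst (psnd z)) (pfst (psnd (psnd z)))
      (pfst (psnd (psnd (psnd z)))) (psnd (psnd (psnd (psnd z)))))"
    and f: "rec_in A f" and g: "rec_in A g"
  shows "rec_in A (\<lambda>x. tree_rec h (f x) (g x))"
proof -
  \<comment> \<open>The table of the values below \<open>n\<close>, the latest one first.\<close>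
  define look where "look n t i = (if i < n then pfst ((psnd ^^ (n - Suc i)) t) else 0)" for n t i
  define next_val where "next_val x n t = h x n (look n t (psnd n)) (look n t (pfst (psnd n)))
    (look n t (psnd (psnd n)))" for x n t
  define table where "table x = rec_nat 0 (\<lambda>n t. prod_encode (next_val x n t, t))" for x
  have look: "look n (table x n) i = (if i < n then next_val x i (table x i) else 0)" for x n i
  proof (induction n)
    case (Suc n)
    show ?case
    proof (cases "i = n")
      case True
      then show ?thesis by (simp add: look_def table_def)
    next
      case False
      \<comment> \<open>The next table has one more entry in front, so the old entries lie one
        \<open>psnd\<close> deeper.\<close>
      have "(psnd ^^ (n - i)) (table x (Suc n)) = (psnd ^^ (n - Suc i)) (table x n)" if "i < n"
      proof -
        have "n - i = Suc (n - Suc i)" using that by simp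
        then show ?thesis by (simp add: table_def funpow_Suc_right del: funpow.simps(2))
      qed
      with False Suc show ?thesis by (auto simp: look_def split: if_splits)
    qed
  qed (simp add: look_def)
  have eq: "next_val x n (table x n) = tree_rec h x n" for x n
  proof (induction n rule: less_induct)
    case (less n)
    have "look n (table x n) i = (if i < n then tree_rec h x i else 0)" for i
      using less look by simp
    then show ?case by (subst tree_rec.simps) (simp add: next_val_def)
  qed
  have look_rec: "rec_in A (\<lambda>x. look (a x) (b x) (c x))"
    if "rec_in A a" "rec_in A b" "rec_in A c" for a b c
    unfolding look_def by (intro rec_intros that)
  have h': "rec_in A (\<lambda>x. h (a x) (b x) (c x) (d x) (e x))"
    if "rec_in A a" "rec_in A b" "rec_in A c" "rec_in A d" "rec_in A e" for a b c d e
    using rec_in_comp[OF h, of "\<lambda>x. prod_encode (a x, prod_encode (b x, prod_encode (c x,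
      prod_encode (d x, e x))))"] that by (simp add: rec_intros)
  have "rec_in A (\<lambda>x. next_val (f x) (g x) (table (f x) (g x)))"
    unfolding next_val_def table_def by (intro rec_intros h' look_rec rec_in_comp[OF f] rec_in_comp[OF g] f g)
  then show ?thesis by (simp add: eq)
qed

section \<open>Universality\<close>

definition prog_code_rec :: "nat \<Rightarrow> nat \<Rightarrow> nat \<Rightarrow> nat \<Rightarrow> nat \<Rightarrow> nat" where
  "prog_code_rec x c u v w =
     (if pfst c < 5 then if psnd c = 0 then 1 else 0
      else if pfst c < 8 then if v = 1 \<and> w = 1 then 1 else 0
      else if pfst c = 8 \<and> u = 1 then 1 else 0)"

lemma prog_code_rec_eq_1:
  "5 \<le> pfst c \<Longrightarrow> prog_code_rec x c u v w = 1 \<longleftrightarrow>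
    (if pfst c < 8 then v = 1 \<and> w = 1 else pfst c = 8 \<and> u = 1)"
  unfolding prog_code_rec_def by simp

text \<open>This check is needed because the machine below also acts on numbers that code no
  program, whereas \<open>W_rel\<close> gives such indices the empty domain.\<close>

definition prog_code :: "nat \<Rightarrow> bool" where
  "prog_code c \<longleftrightarrow> tree_rec prog_code_rec 0 c = 1"

lemma dec_in_prog_code:
  assumes "rec_in A f" shows "dec_in A (\<lambda>x. prog_code (f x))"
proof -
  have node: "rec_in A (\<lambda>x. prog_code_rec (a x) (b x) (c x) (d x) (e x))"
    if "rec_in A a" "rec_in A b" "rec_in A c" "rec_in A d" "rec_in A e" for a b c d e
    unfolding prog_code_rec_def by (intro rec_intros that)
  then show ?thesis
    unfolding prog_code_def by (intro rec_intros rec_in_tree_rec assms node)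
qed

lemma tree_rec_prod_encode:
  "0 < m \<Longrightarrow> tree_rec h x (prod_encode (m, n)) =
    h x (prod_encode (m, n)) (tree_rec h x n) (tree_rec h x (pfst n)) (tree_rec h x (psnd n))"
  by (simp add: tree_rec_node)

lemma prog_code_code_prog: "prog_code (code_prog p)"
  unfolding prog_code_def
proof (induction p)
  case Zero
  show ?case by (subst tree_rec.simps) (simp add: prog_code_rec_def)
qed (simp_all add: tree_rec_prod_encode prog_code_rec_def)

lemma code_prog_leaf: "t < 5 \<Longrightarrow> \<exists>p. code_prog p = prod_encode (t, 0)"
proof -
  assume "t < 5"
  then have "t = 0 \<or> t = 1 \<or> t = 2 \<or> t = 3 \<or> t = 4" by auto
  then show ?thesis by (metis code_prog.simps(1-5))
qed

lemma code_prog_branch: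
  "5 \<le> t \<Longrightarrow> t < 8 \<Longrightarrow> \<exists>r. code_prog r = prod_encode (t, prod_encode (code_prog p, code_prog q))"
proof -
  assume "5 \<le> t" "t < 8"
  then have "t = 5 \<or> t = 6 \<or> t = 7" by auto
  then show ?thesis by (metis code_prog.simps(6-8))
qed

lemma prog_codeD: "prog_code c \<Longrightarrow> \<exists>p. code_prog p = c"
proof (induction c rule: less_induct)
  case (less c)
  define t d where "t = pfst c" and "d = psnd c"
  have c: "c = prod_encode (t, d)" by (simp add: t_def d_def)
  have rec: "tree_rec prog_code_rec 0 c = 1" using less.prems by (simp add: prog_code_def)
  show ?case
  proof (cases "t < 5")
    case True
    with rec have "d = 0"
      by (subst (asm) tree_rec.simps) (simp add: prog_code_rec_def t_def d_def split: if_splits)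
    with c code_prog_leaf[OF True] show ?thesis by simp
  next
    case False
    have dc: "d < c" using False unfolding d_def t_def by (intro psnd_less) simp
    have pos: "0 < pfst c" and ge: "5 \<le> pfst c" using False by (simp_all add: t_def)
    have "if t < 8 then tree_rec prog_code_rec 0 (pfst d) = 1 \<and> tree_rec prog_code_rec 0 (psnd d) = 1
      else t = 8 \<and> tree_rec prog_code_rec 0 d = 1"
      using rec unfolding tree_rec_node[OF pos] prog_code_rec_eq_1[OF ge] t_def d_def .
    then have *: "if t < 8 then prog_code (pfst d) \<and> prog_code (psnd d)
      else t = 8 \<and> prog_code d"
      unfolding prog_code_def .
    show ?thesis
    proof (cases "t < 8")
      case True
      obtain p q where pq: "code_prog p = pfst d" "code_prog q = psnd d"
        using less.IH[of "pfst d"] less.IH[of "psnd d"] * True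
          le_less_trans[OF pfst_le dc] le_less_trans[OF psnd_le dc] by auto
      have "prod_encode (t, prod_encode (code_prog p, code_prog q)) = c"
        by (simp add: pq c)
      with code_prog_branch[of t p q] True False show ?thesis by auto
    next
      case False
      with * less.IH[OF dc] obtain p where "code_prog p = d" "t = 8" by auto
      then have "code_prog (Mu p) = c" by (simp add: c)
      then show ?thesis ..
    qed
  qed
qed

lemma code_prog_inject: "code_prog p = code_prog q \<longleftrightarrow> p = q"
proof (induction p arbitrary: q)
qed (case_tac q; simp)+

lemma W_rel_code_prog: "W_rel A (code_prog p) = {x. \<exists>y. runs A p x y}"
  by (auto simp: W_rel_def code_prog_inject)

text \<open>
  A stack machine for the programs without oracle. A state is a current value paired with a stack of
  instructions, which are codes of programs or, with tags from \<open>9\<close> on, the continuations: the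
  two halves of a pair, the step of a primitive recursion, and the test of a minimisation.
\<close>

definition push :: "nat \<Rightarrow> nat \<Rightarrow> nat" where
  "push i r = Suc (prod_encode (i, r))"

text \<open>Payloads \<open>d\<close> of the continuations: tag 9 holds the second program and the
  saved input, tag 10 the first result, tag 11 the step program with parameter and index, tag 12 the
  body with the input and the candidate under test. Tag 4 answers 0 because the oracle is
  empty.\<close>

definition exec :: "nat \<Rightarrow> nat \<Rightarrow> nat \<Rightarrow> nat \<Rightarrow> nat" where
  "exec tag d v r =
     (if tag = 0 then prod_encode (0, r)
      else if tag = 1 then prod_encode (Suc v, r)
      else if tag = 2 then prod_encode (pfst v, r)
      else if tag = 3 then prod_encode (psnd v, r)
      else if tag = 4 then prod_encode (0, r)
      else if tag = 5 then
        prod_encode (v, push (pfst d) (push (prod_encode (9, prod_encode (psnd d, v))) r))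
      else if tag = 6 then prod_encode (v, push (psnd d) (push (pfst d) r))
      else if tag = 7 then
        (if psnd v = 0 then prod_encode (pfst v, push (pfst d) r)
         else prod_encode (prod_encode (pfst v, psnd v - 1), push (prod_encode (7, d))
           (push (prod_encode (11, prod_encode (psnd d, prod_encode (pfst v, psnd v - 1)))) r)))
      else if tag = 8 then
        prod_encode (prod_encode (v, 0),
          push d (push (prod_encode (12, prod_encode (d, prod_encode (v, 0)))) r))
      else if tag = 9 then
        prod_encode (psnd d, push (pfst d) (push (prod_encode (10, v)) r))
      else if tag = 10 then prod_encode (prod_encode (d, v), r)
      else if tag = 11 then
        prod_encode (prod_encode (pfst (psnd d), prod_encode (psnd (psnd d), v)), push (pfst d) r)
      else if v = 0 then prod_encode (psnd (psnd d), r)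
      else prod_encode (prod_encode (pfst (psnd d), Suc (psnd (psnd d))), push (pfst d)
        (push (prod_encode (12, prod_encode (pfst d,
          prod_encode (pfst (psnd d), Suc (psnd (psnd d)))))) r)))"

definition machine_step :: "nat \<Rightarrow> nat" where
  "machine_step s =
     (if psnd s = 0 then s
      else exec (pfst (pfst (psnd s - 1))) (psnd (pfst (psnd s - 1))) (pfst s) (psnd (psnd s - 1)))"

lemma rec_in_machine_step:
  assumes "rec_in A f" shows "rec_in A (\<lambda>x. machine_step (f x))"
proof -
  have exec: "rec_in A (\<lambda>x. exec (a x) (b x) (c x) (d x))"
    if "rec_in A a" "rec_in A b" "rec_in A c" "rec_in A d" for a b c d
    unfolding exec_def push_def by (intro rec_intros that)
  then show ?thesis
    unfolding machine_step_def by (intro rec_intros assms exec)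
qed

lemma machine_step_push:
  "machine_step (prod_encode (v, push (prod_encode (tag, d)) r)) = exec tag d v r"
  by (simp add: machine_step_def push_def)

section \<open>Correctness of the stack machine\<close>

definition reaches :: "nat \<Rightarrow> nat \<Rightarrow> bool" where
  "reaches s t \<longleftrightarrow> (\<exists>n. (machine_step ^^ n) s = t)"

lemma reaches_refl: "reaches s s"
  unfolding reaches_def by (rule exI[of _ 0]) simp

lemma reaches_trans: "reaches s t \<Longrightarrow> reaches t u \<Longrightarrow> reaches s u"
  unfolding reaches_def by (metis funpow_add o_apply)

lemma reaches_step: "reaches (machine_step s) t \<Longrightarrow> reaches s t"
  unfolding reaches_def by (metis funpow_Suc_right o_apply)

lemma reaches_push:
  "reaches (exec tag d v r) t \<Longrightarrow> reaches (prod_encode (v, push (prod_encode (tag, d)) r)) t"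
  by (rule reaches_step) (simp add: machine_step_push)

text \<open>The rest \<open>r\<close> of the stack is arbitrary, so that the induction hypotheses
  apply with continuations waiting below a subprogram.\<close>

lemma machine_complete:
  assumes "runs {} p x y"
  shows "reaches (prod_encode (x, push (code_prog p) r)) (prod_encode (y, r))"
  using assms
proof (induction arbitrary: r rule: runs.induct)
  case (Tuple p x y q z)
  show ?case
    by (simp, rule reaches_push, simp add: exec_def, rule reaches_trans[OF Tuple.IH(1)],
        rule reaches_push, simp add: exec_def, rule reaches_trans[OF Tuple.IH(2)],
        rule reaches_push, simp add: exec_def reaches_refl)
next
  case (Compose q x y p z)
  show ?case
    by (simp, rule reaches_push, simp add: exec_def, rule reaches_trans[OF Compose.IH(1)],
        rule Compose.IH(2))
next
  case (PRec_0 p a y q)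
  show ?case
    by (simp, rule reaches_push, simp add: exec_def, rule PRec_0.IH)
next
  case (PRec_Suc p q a n y z)
  show ?case
    by (simp, rule reaches_push, simp add: exec_def,
        rule reaches_trans[OF PRec_Suc.IH(1)[unfolded code_prog.simps]],
        rule reaches_push, simp add: exec_def, rule PRec_Suc.IH(2))
next
  case (Mu p x n)
  \<comment> \<open>The state about to evaluate candidate \<open>m\<close>, with its test waiting on
    the stack.\<close>
  let ?s = "\<lambda>m. prod_encode (prod_encode (x, m), push (code_prog p)
    (push (prod_encode (12, prod_encode (code_prog p, prod_encode (x, m)))) r))"
  have start: "reaches (?s 0) (?s m)" if "m \<le> n" for m
    using that
  proof (induction m)
    case (Suc m)
    then obtain k where "\<And>r. reaches (prod_encode (prod_encode (x, m), push (code_prog p) r))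
        (prod_encode (Suc k, r))"
      using Mu.IH(2) by (meson Suc_le_eq)
    then have "reaches (?s m) (prod_encode (Suc k,
        push (prod_encode (12, prod_encode (code_prog p, prod_encode (x, m)))) r))" .
    moreover have "reaches (prod_encode (Suc k,
        push (prod_encode (12, prod_encode (code_prog p, prod_encode (x, m)))) r)) (?s (Suc m))"
      by (rule reaches_push) (simp add: exec_def reaches_refl)
    ultimately show ?case using Suc by (meson Suc_leD reaches_trans)
  qed (simp add: reaches_refl)
  show ?case
    by (simp, rule reaches_push, simp add: exec_def, rule reaches_trans[OF start[OF order_refl]],
        rule reaches_trans[OF Mu.IH(1)], rule reaches_push, simp add: exec_def reaches_refl)
qed (simp, rule reaches_push, simp add: exec_def reaches_refl)+

definition halts_in :: "nat \<Rightarrow> nat \<Rightarrow> bool" where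
  "halts_in n s \<longleftrightarrow> psnd ((machine_step ^^ n) s) = 0"

lemma halts_in_push:
  "halts_in n (prod_encode (v, push (prod_encode (tag, d)) r)) \<longleftrightarrow>
    (\<exists>m. n = Suc m \<and> halts_in m (exec tag d v r))"
proof (cases n)
  case 0
  then show ?thesis by (simp add: halts_in_def push_def)
next
  case (Suc m)
  then show ?thesis
    by (simp add: halts_in_def funpow_Suc_right machine_step_push del: funpow.simps(2))
qed

text \<open>Induction on the number of steps rather than on the program, because primitive recursion
  and minimisation re-enter the same code. A halting run must pop down to \<open>r\<close>, and
  fewer steps then remain, so the induction hypothesis also covers the subprograms run
  afterwards.\<close>

lemma machine_sound:
  "halts_in n (prod_encode (x, push (code_prog p) r)) \<Longrightarrow>
    \<exists>y. runs {} p x y \<and> (\<exists>m<n. halts_in m (prod_encode (y, r)))"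
proof (induction n arbitrary: x p r rule: less_induct)
  case (less n)
  note IH = less.IH and * = less.prems
  show ?case
  proof (cases p)
    case Zero
    with * show ?thesis by (auto simp: halts_in_push exec_def intro: runs.intros)
  next
    case Succ
    with * show ?thesis by (auto simp: halts_in_push exec_def intro: runs.intros)
  next
    case Left
    with * show ?thesis by (auto simp: halts_in_push exec_def intro: runs_pfst)
  next
    case Right
    with * show ?thesis by (auto simp: halts_in_push exec_def intro: runs_psnd)
  next
    case Query
    with * show ?thesis using runs.Query[of "{}" x] by (auto simp: halts_in_push exec_def)
  next
    case (Tuple p1 p2)
    with * obtain n1 where n1: "n1 < n" "halts_in n1 (prod_encode (x, push (code_prog p1)
        (push (prod_encode (9, prod_encode (code_prog p2, x))) r)))"
      by (auto simp: halts_in_push exec_def)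
    from less.IH[OF this] obtain y1 n2 where y1: "runs {} p1 x y1" and "n2 < n1"
      "halts_in n2 (prod_encode (y1, push (prod_encode (9, prod_encode (code_prog p2, x))) r))"
      by blast
    then obtain n3 where n3: "n3 < n2"
      "halts_in n3 (prod_encode (x, push (code_prog p2) (push (prod_encode (10, y1)) r)))"
      by (auto simp: halts_in_push exec_def)
    with less.IH[of n3] n1 \<open>n2 < n1\<close> obtain y2 n4 where y2: "runs {} p2 x y2" and "n4 < n3"
      "halts_in n4 (prod_encode (y2, push (prod_encode (10, y1)) r))"
      by (meson less_trans)
    then obtain n5 where "n5 < n4" "halts_in n5 (prod_encode (prod_encode (y1, y2), r))"
      by (auto simp: halts_in_push exec_def)
    with Tuple y1 y2 n1 \<open>n2 < n1\<close> n3 \<open>n4 < n3\<close> show ?thesis by (meson less_trans runs.Tuple)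
  next
    case (Compose p1 p2)
    with * obtain n1 where n1: "n1 < n" "halts_in n1 (prod_encode (x, push (code_prog p2)
        (push (code_prog p1) r)))"
      by (auto simp: halts_in_push exec_def)
    from less.IH[OF this] obtain y1 n2 where y1: "runs {} p2 x y1" and n2: "n2 < n1"
      "halts_in n2 (prod_encode (y1, push (code_prog p1) r))"
      by blast
    with less.IH[of n2] n1 obtain y2 n3 where "runs {} p1 y1 y2" "n3 < n2"
      "halts_in n3 (prod_encode (y2, r))"
      by (meson less_trans)
    with Compose y1 n1 n2 show ?thesis by (meson less_trans runs.Compose)
  next
    case (PRec p1 p2)
    obtain a k where x: "x = prod_encode (a, k)" by (metis prod_encode_pfst_psnd)
    show ?thesis
    proof (cases k)
      case 0
      with * PRec x obtain n1 where n1: "n1 < n" "halts_in n1 (prod_encode (a, push (code_prog p1) r))"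
        by (auto simp: halts_in_push exec_def)
      with less.IH[OF this] PRec x 0 show ?thesis by (meson less_trans runs.PRec_0)
    next
      case (Suc j)
      with * PRec x obtain n1 where n1: "n1 < n"
        "halts_in n1 (prod_encode (prod_encode (a, j), push (code_prog p)
          (push (prod_encode (11, prod_encode (code_prog p2, prod_encode (a, j)))) r)))"
        by (auto simp: halts_in_push exec_def)
      from less.IH[OF this] obtain y1 n2 where y1: "runs {} p (prod_encode (a, j)) y1" and "n2 < n1"
        "halts_in n2 (prod_encode (y1,
          push (prod_encode (11, prod_encode (code_prog p2, prod_encode (a, j)))) r))"
        by blast
      then obtain n3 where n3: "n3 < n2"
        "halts_in n3 (prod_encode (prod_encode (a, prod_encode (j, y1)), push (code_prog p2) r))"
        by (auto simp: halts_in_push exec_def)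
      with less.IH[of n3] n1 \<open>n2 < n1\<close> obtain y2 n4
        where "runs {} p2 (prod_encode (a, prod_encode (j, y1))) y2" "n4 < n3"
        "halts_in n4 (prod_encode (y2, r))"
        by (meson less_trans)
      with PRec x Suc y1 n1 \<open>n2 < n1\<close> n3 show ?thesis by (meson less_trans runs.PRec_Suc)
    qed
  next
    case (Mu q)
    let ?s = "\<lambda>j. prod_encode (prod_encode (x, j), push (code_prog q)
      (push (prod_encode (12, prod_encode (code_prog q, prod_encode (x, j)))) r))"
    \<comment> \<open>Generalised to a search already at candidate \<open>j\<close>, by induction on
      the steps left: a zero ends the search, a successor moves it to \<open>Suc j\<close> with
      fewer steps.\<close>
    have search: "\<exists>y. runs {} (Mu q) x y \<and> (\<exists>m'<n. halts_in m' (prod_encode (y, r)))"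
      if "m < n" "halts_in m (?s j)" "\<forall>i<j. \<exists>k. runs {} q (prod_encode (x, i)) (Suc k)" for m j
      using that
    proof (induction m arbitrary: j rule: less_induct)
      case (less m)
      from IH[OF less.prems(1,2)] obtain z m1 where
        z: "runs {} q (prod_encode (x, j)) z" and "m1 < m" "halts_in m1 (prod_encode (z,
          push (prod_encode (12, prod_encode (code_prog q, prod_encode (x, j)))) r))"
        by blast
      then obtain m2 where m2: "m2 < m1" "halts_in m2 (if z = 0 then prod_encode (j, r) else ?s (Suc j))"
        by (auto simp: halts_in_push exec_def cong del: if_weak_cong)
      show ?case
      proof (cases z)
        case 0
        then have "runs {} (Mu q) x j" using z less.prems by (auto intro: runs.Mu)
        moreover have "m2 < n" using m2(1) \<open>m1 < m\<close> less.prems by linarith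
        ultimately show ?thesis using m2(2) 0 by auto
      next
        case (Suc k)
        show ?thesis
        proof (rule less.IH)
          show "m2 < m" "m2 < n" using m2(1) \<open>m1 < m\<close> less.prems by linarith+
          show "halts_in m2 (?s (Suc j))" using m2(2) Suc by simp
          show "\<forall>i<Suc j. \<exists>k. runs {} q (prod_encode (x, i)) (Suc k)"
            using less.prems z Suc by (auto simp: less_Suc_eq)
        qed
      qed
    qed
    from * Mu obtain n1 where "n1 < n" "halts_in n1 (?s 0)"
      by (auto simp: halts_in_push exec_def)
    with search Mu show ?thesis by blast
  qed
qed

section \<open>The halting problem\<close>

definition halts_within :: "nat \<Rightarrow> nat \<Rightarrow> bool" where
  "halts_within x t \<longleftrightarrow> prog_code x \<and> halts_in t (prod_encode (x, push x 0))"

lemma dec_in_halts_within: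
  "rec_in A f \<Longrightarrow> rec_in A g \<Longrightarrow> dec_in A (\<lambda>x. halts_within (f x) (g x))"
  unfolding halts_within_def halts_in_def push_def
  by (intro rec_intros dec_in_prog_code rec_in_machine_step)

text \<open>Kleene normal form on the diagonal: membership in the jump is the projection of a
  decidable relation, by completeness and soundness of the machine.\<close>

lemma jump_iff: "x \<in> jump {} \<longleftrightarrow> (\<exists>t. halts_within x t)"
proof
  assume "x \<in> jump {}"
  then obtain p y where p: "code_prog p = x" and "runs {} p x y"
    unfolding jump_def W_rel_def by blast
  from machine_complete[OF this(2), of 0]
  obtain n where "(machine_step ^^ n) (prod_encode (x, push x 0)) = prod_encode (y, 0)"
    unfolding p reaches_def ..
  then have "halts_within x n"
    using prog_code_code_prog[of p] by (simp add: halts_within_def halts_in_def p)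
  then show "\<exists>t. halts_within x t" ..
next
  assume "\<exists>t. halts_within x t"
  then obtain t p where p: "code_prog p = x" and "halts_in t (prod_encode (x, push x 0))"
    unfolding halts_within_def using prog_codeD by blast
  then have "halts_in t (prod_encode (x, push (code_prog p) 0))" by simp
  from machine_sound[OF this] obtain y where "runs {} p x y" by blast
  then show "x \<in> jump {}"
    unfolding jump_def using W_rel_code_prog[of "{}" p] by (auto simp: p)
qed

lemma jump_not_recursive: "\<not> dec_in {} (\<lambda>x. x \<in> jump {})"
proof
  assume "dec_in {} (\<lambda>x. x \<in> jump {})"
  \<comment> \<open>The search variable is a dummy: the search succeeds at once or never. A program
    halting exactly off the jump is then refuted at its own code.\<close>
  then have "dec_in {} (\<lambda>z. \<not> pfst z \<in> jump {})"
    by (rule dec_in_not[OF dec_in_comp[OF _ rec_in_pfst[OF rec_in_id]]])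
  from domain_search[OF this] obtain p where
    p: "\<And>x. (\<exists>y. runs {} p x y) \<longleftrightarrow> x \<notin> jump {}" by auto
  have "code_prog p \<in> jump {} \<longleftrightarrow> (\<exists>y. runs {} p (code_prog p) y)"
    unfolding jump_def by (simp add: W_rel_code_prog)
  then show False using p by blast
qed

section \<open>The parameter theorem\<close>

fun const_prog :: "nat \<Rightarrow> prog" where
  "const_prog 0 = Zero"
| "const_prog (Suc n) = Compose Succ (const_prog n)"

lemma runs_const_prog: "runs A (const_prog n) x n"
  by (induction n) (auto intro: runs.intros)

text \<open>The parameter is hard-wired by pairing the output of a constant program with the input,
  through \<open>Tuple Left Right\<close> as the identity. The code of the constant program is
  primitive recursive in the constant, so the index is a recursive function of
  \<open>n\<close>.\<close>

lemma smn_ex: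
  assumes "dec_in {} (\<lambda>z. P (pfst (pfst z)) (psnd (pfst z)) (psnd z))"
  obtains j where "rec_in {} j" "\<And>n. W (j n) = {c. \<exists>t. P n c t}"
proof -
  obtain p where p: "\<And>x. (\<exists>y. runs {} p x y) \<longleftrightarrow> (\<exists>t. P (pfst x) (psnd x) t)"
    by (rule domain_search[where P = "\<lambda>x. P (pfst x) (psnd x)", OF assms]) (rule that)
  define j where "j n = code_prog (Compose p (Tuple (const_prog n) (Tuple Left Right)))" for n
  have const: "code_prog (const_prog n) =
      rec_nat (prod_encode (0, 0)) (\<lambda>_ y. prod_encode (6, prod_encode (prod_encode (1, 0), y))) n" for n
    by (induction n) auto
  have "rec_in {} j"
    unfolding j_def[abs_def] code_prog.simps const
    by (rule rec_intros)+
  moreover have "W (j n) = {c. \<exists>t. P n c t}" for n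
  proof -
    have id: "runs {} (Tuple Left Right) c c" for c
      using runs.Tuple[OF runs_pfst runs_psnd, of "{}" c] by simp
    have arg: "runs {} (Tuple (const_prog n) (Tuple Left Right)) c (prod_encode (n, c))" for c
      by (intro runs.Tuple runs_const_prog id)
    have "(\<exists>y. runs {} (Compose p (Tuple (const_prog n) (Tuple Left Right))) c y)
        \<longleftrightarrow> (\<exists>y. runs {} p (prod_encode (n, c)) y)" for c
    proof
      assume "\<exists>y. runs {} (Compose p (Tuple (const_prog n) (Tuple Left Right))) c y"
      then obtain y z where "runs {} (Tuple (const_prog n) (Tuple Left Right)) c z" "runs {} p z y"
        by (blast elim: runs_ComposeE)
      with runs_deterministic[OF arg] show "\<exists>y. runs {} p (prod_encode (n, c)) y" by auto
    qed (use runs.Compose[OF arg] in blast)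
    then show ?thesis
      unfolding j_def W_rel_code_prog by (simp add: p)
  qed
  ultimately show thesis using that by blast
qed

section \<open>One-point models\<close>

definition unary_language :: language where
  "unary_language = \<lparr>funs = {}, rels = {(r, k). k = 1}\<rparr>"

lemma recursive_unary_language: "recursive_language unary_language"
proof -
  have "prod_encode ` {(r, k). k = 1} = {z. psnd z = 1}"
    by (auto simp: image_iff psnd_def) (metis prod.collapse prod_decode_inverse)
  moreover have "dec_in {} (\<lambda>z. psnd z = 1)" "dec_in {} (\<lambda>z. False)" by (intro rec_intros)+
  ultimately show ?thesis
    unfolding recursive_language_def recursive_set_def recursive_fun_iff
    by (auto simp: unary_language_def dec_in_def)
qed

text \<open>
  Truth in the one-point model in which all predicates hold except the \<open>k\<close>-th one. There, an
  assignment of the variables makes no difference, and quantifiers are void.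
\<close>

primrec holds :: "nat \<Rightarrow> fm \<Rightarrow> bool" where
  "holds k Falsum \<longleftrightarrow> False"
| "holds k (Eq s t) \<longleftrightarrow> True"
| "holds k (Rel r ts) \<longleftrightarrow> r \<noteq> k"
| "holds k (Imp p q) \<longleftrightarrow> (holds k p \<longrightarrow> holds k q)"
| "holds k (All p) \<longleftrightarrow> holds k p"

lemma holds_subst_fm: "holds k (subst_fm \<sigma> p) \<longleftrightarrow> holds k p"
  by (induction p arbitrary: \<sigma>) auto

text \<open>Substitution does not affect truth in a one-point model, so the quantifier and equality
  axioms become propositional tautologies.\<close>

lemma proves_sound: "proves L T p \<Longrightarrow> (\<And>q. q \<in> T \<Longrightarrow> holds k q) \<Longrightarrow> holds k p"
  by (induction rule: proves.induct) (auto simp: inst_def holds_subst_fm)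

text \<open>Every predicate name in a formula is smaller than its code, so a failing predicate of
  larger index does not occur in it.\<close>

lemma holds_above_code:
  "code_fm p < k \<Longrightarrow> code_fm p < k' \<Longrightarrow> holds k p \<longleftrightarrow> holds k' p"
proof (induction p)
  case (Rel r ts)
  have "r < code_fm (Rel r ts)"
    by (simp add: le_less_trans[OF le_prod_encode_1 child_less])
  with Rel show ?case by simp
next
  case (Imp p q)
  have "code_fm p < code_fm (Imp p q)" "code_fm q < code_fm (Imp p q)"
    by (simp_all add: le_less_trans[OF le_prod_encode_1 child_less]
        le_less_trans[OF le_prod_encode_2 child_less])
  with Imp show ?case by simp
next
  case (All p)
  have "code_fm p < code_fm (All p)" by (simp add: child_less)
  with All show ?case by simp
qed simp_all

definition holds_rec :: "nat \<Rightarrow> nat \<Rightarrow> nat \<Rightarrow> nat \<Rightarrow> nat \<Rightarrow> nat" where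
  "holds_rec k c u v w =
     (if pfst c = 0 then 0
      else if pfst c = 1 then 1
      else if pfst c = 2 then if pfst (psnd c) = k then 0 else 1
      else if pfst c = 3 then if v = 1 then w else 1
      else u)"

definition holds_code :: "nat \<Rightarrow> nat \<Rightarrow> bool" where
  "holds_code k c \<longleftrightarrow> tree_rec holds_rec k c = 1"

lemma holds_code_iff: "holds_code k (code_fm p) \<longleftrightarrow> holds k p"
proof -
  have "tree_rec holds_rec k (code_fm p) = (if holds k p then 1 else 0)"
  proof (induction p)
    case Falsum
    show ?case by (subst tree_rec.simps) (simp add: holds_rec_def)
  qed (simp_all add: tree_rec_prod_encode holds_rec_def)
  then show ?thesis by (simp add: holds_code_def)
qed

lemma dec_in_holds_code:
  assumes "rec_in A f" "rec_in A g" shows "dec_in A (\<lambda>x. holds_code (f x) (g x))"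
proof -
  have node: "rec_in A (\<lambda>x. holds_rec (a x) (b x) (c x) (d x) (e x))"
    if "rec_in A a" "rec_in A b" "rec_in A c" "rec_in A d" "rec_in A e" for a b c d e
    unfolding holds_rec_def by (intro rec_intros that)
  show ?thesis
    unfolding holds_code_def by (intro rec_intros rec_in_tree_rec assms node)
qed

text \<open>
  The value is \<open>Suc n\<close> at the code of a formula over the unary language whose free variables have
  least strict upper bound \<open>n\<close>, and \<open>0\<close> at all other numbers. The term \<open>a + (b - a)\<close> is a
  maximum.
\<close>

definition fm_rank_rec :: "nat \<Rightarrow> nat \<Rightarrow> nat \<Rightarrow> nat \<Rightarrow> nat \<Rightarrow> nat" where
  "fm_rank_rec x c u v w =
     (if pfst c = 0 then if psnd c = 0 then 1 else 0
      else if pfst c = 1 then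
        if pfst (pfst (psnd c)) = 0 \<and> pfst (psnd (psnd c)) = 0
        then Suc (Suc (psnd (pfst (psnd c)) + (psnd (psnd (psnd c)) - psnd (pfst (psnd c)))))
        else 0
      else if pfst c = 2 then
        if 0 < psnd (psnd c) \<and> psnd (psnd (psnd c) - 1) = 0 \<and> pfst (pfst (psnd (psnd c) - 1)) = 0
        then Suc (Suc (psnd (pfst (psnd (psnd c) - 1))))
        else 0
      else if pfst c = 3 then if 0 < v \<and> 0 < w then v + (w - v) else 0
      else if pfst c = 4 \<and> 0 < u then Suc (u - 2)
      else 0)"

definition fm_rank :: "nat \<Rightarrow> nat" where
  "fm_rank c = tree_rec fm_rank_rec 0 c"

lemma rec_in_fm_rank:
  assumes "rec_in A f" shows "rec_in A (\<lambda>x. fm_rank (f x))"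
proof -
  have node: "rec_in A (\<lambda>x. fm_rank_rec (a x) (b x) (c x) (d x) (e x))"
    if "rec_in A a" "rec_in A b" "rec_in A c" "rec_in A d" "rec_in A e" for a b c d e
    unfolding fm_rank_rec_def by (intro rec_intros that)
  show ?thesis
    unfolding fm_rank_def by (intro rec_intros rec_in_tree_rec assms node)
qed

lemma wf_tm_unary_language: "wf_tm unary_language t \<longleftrightarrow> (\<exists>i. t = Var i)"
  by (cases t) (auto simp: unary_language_def)

lemma fm_rank_prod_encode:
  "0 < m \<Longrightarrow> fm_rank (prod_encode (m, d)) =
    fm_rank_rec 0 (prod_encode (m, d)) (fm_rank d) (fm_rank (pfst d)) (fm_rank (psnd d))"
  by (simp add: fm_rank_def tree_rec_prod_encode)

lemma fm_rank_Eq: "fm_rank (code_fm (Eq (Var i) (Var j))) = Suc (Suc (i + (j - i)))"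
  unfolding code_fm.simps fm_rank_prod_encode[OF zero_less_one] by (simp add: fm_rank_rec_def)

lemma fm_rank_Rel: "fm_rank (code_fm (Rel r [Var i])) = Suc (Suc i)"
  unfolding code_fm.simps fm_rank_prod_encode[OF zero_less_numeral] by (simp add: fm_rank_rec_def)

lemma fm_rank_Imp:
  "fm_rank (code_fm (Imp p q)) =
    (if 0 < fm_rank (code_fm p) \<and> 0 < fm_rank (code_fm q)
     then fm_rank (code_fm p) + (fm_rank (code_fm q) - fm_rank (code_fm p)) else 0)"
  unfolding code_fm.simps fm_rank_prod_encode[OF zero_less_numeral] by (simp add: fm_rank_rec_def)

lemma fm_rank_All:
  "fm_rank (code_fm (All p)) = (if 0 < fm_rank (code_fm p) then Suc (fm_rank (code_fm p) - 2) else 0)"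
  unfolding code_fm.simps fm_rank_prod_encode[OF zero_less_numeral] by (simp add: fm_rank_rec_def)

lemma fm_rank_code_fm:
  assumes "wf_fm unary_language p"
  shows "\<exists>n. fm_rank (code_fm p) = Suc n \<and> (\<forall>m. closed_fm m p \<longleftrightarrow> n \<le> m)"
  using assms
proof (induction p)
  case Falsum
  have "fm_rank (code_fm Falsum) = Suc 0"
    unfolding fm_rank_def by (subst tree_rec.simps) (simp add: fm_rank_rec_def)
  then show ?case by (intro exI[of _ 0]) simp
next
  case (Eq s t)
  then obtain i j where "s = Var i" "t = Var j" by (auto simp: wf_tm_unary_language)
  then show ?case
    by (intro exI[of _ "Suc (i + (j - i))"]) (auto simp: fm_rank_Eq simp del: code_fm.simps)
next
  case (Rel r ts)
  have "length ts = 1" using Rel by (simp add: unary_language_def)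
  moreover have "\<forall>t \<in> set ts. \<exists>i. t = Var i" using Rel by (simp add: wf_tm_unary_language)
  ultimately obtain i where "ts = [Var i]" by (auto simp: length_Suc_conv)
  then show ?case
    by (intro exI[of _ "Suc i"]) (auto simp: fm_rank_Rel simp del: code_fm.simps)
next
  case (Imp p q)
  have wf: "wf_fm unary_language p" "wf_fm unary_language q" using Imp.prems by simp_all
  obtain n where n: "fm_rank (code_fm p) = Suc n" "\<forall>i. closed_fm i p \<longleftrightarrow> n \<le> i"
    using Imp.IH(1)[OF wf(1)] by blast
  obtain m where m: "fm_rank (code_fm q) = Suc m" "\<forall>i. closed_fm i q \<longleftrightarrow> m \<le> i"
    using Imp.IH(2)[OF wf(2)] by blast
  have "fm_rank (code_fm (Imp p q)) = Suc (n + (m - n))"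
    unfolding fm_rank_Imp n m by simp
  moreover have "closed_fm i (Imp p q) \<longleftrightarrow> n + (m - n) \<le> i" for i
    using n(2) m(2) by (simp only: closed_fm.simps) linarith
  ultimately show ?case by blast
next
  case (All p)
  have wf: "wf_fm unary_language p" using All.prems by simp
  obtain n where n: "fm_rank (code_fm p) = Suc n" "\<forall>i. closed_fm i p \<longleftrightarrow> n \<le> i"
    using All.IH[OF wf] by blast
  \<comment> \<open>The stored value is \<open>Suc n\<close>, so the \<open>u - 2\<close> of the
    recursion is \<open>n - 1\<close>; truncation handles a quantifier over a closed
    formula.\<close>
  have "fm_rank (code_fm (All p)) = Suc (n - 1)"
    unfolding fm_rank_All n by simp
  moreover have "closed_fm i (All p) \<longleftrightarrow> n - 1 \<le> i" for i
    using n(2)[rule_format, of "Suc i"] by (simp only: closed_fm.simps) linarith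
  ultimately show ?case by blast
qed

lemma fm_rank_posD: "0 < fm_rank c \<Longrightarrow> \<exists>p. code_fm p = c \<and> wf_fm unary_language p"
proof (induction c rule: less_induct)
  case (less c)
  define t d where "t = pfst c" and "d = psnd c"
  have c: "c = prod_encode (t, d)" by (simp add: t_def d_def)
  show ?case
  proof (cases "t = 0")
    case True
    with less.prems have "d = 0"
      unfolding fm_rank_def
      by (subst (asm) tree_rec.simps) (simp add: fm_rank_rec_def t_def d_def split: if_splits)
    with c True have "code_fm Falsum = c" by simp
    then show ?thesis by (intro exI[of _ Falsum]) simp
  next
    case False
    have dc: "d < c" using False unfolding d_def t_def by (intro psnd_less) simp
    have rank: "0 < fm_rank_rec 0 c (fm_rank d) (fm_rank (pfst d)) (fm_rank (psnd d))"
      using less.prems tree_rec_node[of c fm_rank_rec 0] False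
      unfolding fm_rank_def t_def d_def by simp
    then have "t \<le> 4" by (simp add: fm_rank_rec_def t_def split: if_splits)
    with False consider "t = 1" | "t = 2" | "t = 3" | "t = 4" by linarith
    then show ?thesis
    proof cases
      case 1
      with rank have "pfst (pfst d) = 0" "pfst (psnd d) = 0"
        by (simp_all add: fm_rank_rec_def t_def d_def split: if_splits)
      then have "code_tm (Var (psnd (pfst d))) = pfst d" "code_tm (Var (psnd (psnd d))) = psnd d"
        by (metis code_tm.simps(1) prod_encode_pfst_psnd)+
      then have "code_fm (Eq (Var (psnd (pfst d))) (Var (psnd (psnd d)))) = c"
        using c 1 by (simp del: code_tm.simps)
      then show ?thesis
        by (intro exI[of _ "Eq (Var (psnd (pfst d))) (Var (psnd (psnd d)))"]) simp
    next
      case 2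
      \<comment> \<open>A one-element list has code \<open>Suc (prod_encode (x, 0))\<close>;
        \<open>l\<close> strips the successor.\<close>
      define l where "l = psnd d - 1"
      from 2 rank have *: "0 < psnd d" "psnd l = 0" "pfst (pfst l) = 0"
        by (simp_all add: fm_rank_rec_def t_def d_def l_def split: if_splits)
      have "code_tm (Var (psnd (pfst l))) = pfst l"
        using * by (metis code_tm.simps(1) prod_encode_pfst_psnd)
      moreover have "prod_encode (pfst l, 0) = l"
        using * by (metis prod_encode_pfst_psnd)
      ultimately have "list_encode (map code_tm [Var (psnd (pfst l))]) = psnd d"
        using * by (simp add: l_def del: code_tm.simps)
      then have "code_fm (Rel (pfst d) [Var (psnd (pfst l))]) = c"
        using c 2 by (simp del: code_tm.simps list.map)
      then show ?thesis
        by (intro exI[of _ "Rel (pfst d) [Var (psnd (pfst l))]"]) (simp add: unary_language_def)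
    next
      case 3
      with rank have "0 < fm_rank (pfst d)" "0 < fm_rank (psnd d)"
        by (simp_all add: fm_rank_rec_def t_def[symmetric] split: if_splits)
      with less.IH le_less_trans[OF pfst_le dc] le_less_trans[OF psnd_le dc]
      obtain p q where "code_fm p = pfst d" "wf_fm unary_language p"
        "code_fm q = psnd d" "wf_fm unary_language q" by meson
      then show ?thesis using c 3 by (intro exI[of _ "Imp p q"]) simp
    next
      case 4
      with rank have "0 < fm_rank d"
        by (simp add: fm_rank_rec_def t_def[symmetric] split: if_splits)
      with less.IH[OF dc] obtain p where "code_fm p = d" "wf_fm unary_language p" by auto
      then show ?thesis using c 4 by (intro exI[of _ "All p"]) simp
    qed
  qed
qed

lemma fm_rank_eq_1_iff: "fm_rank c = 1 \<longleftrightarrow> (\<exists>p. code_fm p = c \<and> sentence unary_language p)"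
proof
  assume "fm_rank c = 1"
  then obtain p where p: "code_fm p = c" "wf_fm unary_language p"
    using fm_rank_posD[of c] by auto
  with fm_rank_code_fm[of p] \<open>fm_rank c = 1\<close> show "\<exists>p. code_fm p = c \<and> sentence unary_language p"
    by (auto simp: sentence_def)
next
  assume "\<exists>p. code_fm p = c \<and> sentence unary_language p"
  then obtain p where p: "code_fm p = c" "wf_fm unary_language p" "closed_fm 0 p"
    by (auto simp: sentence_def)
  with fm_rank_code_fm[of p] show "fm_rank c = 1" by auto
qed

section \<open>True stages of an enumeration\<close>

definition true_stage :: "(nat \<Rightarrow> nat) \<Rightarrow> nat \<Rightarrow> bool" where
  "true_stage f i \<longleftrightarrow> (\<forall>s>i. f i \<le> f s)"

text \<open>A stage minimising \<open>f\<close> from \<open>n\<close> onwards is true.\<close>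

lemma true_stage_ge: "\<exists>i\<ge>n. true_stage f i"
proof -
  obtain i where "n \<le> i" "\<forall>s. n \<le> s \<longrightarrow> f i \<le> f s"
    using ex_has_least_nat[of "\<lambda>s. n \<le> s" n f] by auto
  then show ?thesis unfolding true_stage_def by (metis less_imp_le order_trans)
qed

text \<open>An injective \<open>f\<close> takes values below \<open>n\<close> only finitely often;
  any true stage after these will do.\<close>

lemma true_stage_ge_value:
  assumes "inj f" shows "\<exists>i. true_stage f i \<and> n \<le> f i"
proof -
  have "finite (f -` {..<n})" using assms by (intro finite_vimageI) auto
  then obtain m where "\<forall>s \<in> f -` {..<n}. s < m" using finite_nat_set_iff_bounded by blast
  then have "\<And>s. m \<le> s \<Longrightarrow> n \<le> f s" by (auto simp: not_less[symmetric])
  with true_stage_ge[of m f] show ?thesis by blast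
qed

text \<open>Past the true stage \<open>i\<close> all values are at least \<open>f i\<close>, so
  whatever falls below \<open>f k\<close> does so by stage \<open>i\<close>. A known true stage thus
  makes the earlier ones decidable.\<close>

lemma true_stage_iff_upto:
  assumes "true_stage f i" "k \<le> i"
  shows "true_stage f k \<longleftrightarrow> (\<forall>s\<le>i. k < s \<longrightarrow> f k \<le> f s)"
proof
  assume *: "\<forall>s\<le>i. k < s \<longrightarrow> f k \<le> f s"
  then have "f k \<le> f i" using assms(2) by (cases "k = i") auto
  with * assms(1) show "true_stage f k"
    unfolding true_stage_def by (metis not_less order_trans)
qed (simp add: true_stage_def)

lemma range_bounded_search:
  assumes "true_stage f i" "x \<le> f i" "i \<le> b"
  shows "x \<in> range f \<longleftrightarrow> (\<exists>t\<le>b. f t = x)"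
proof
  assume "x \<in> range f"
  then obtain t where t: "f t = x" by auto
  show "\<exists>t\<le>b. f t = x"
  proof (cases "t \<le> i")
    case True
    with t assms(3) show ?thesis by (intro exI[of _ t]) simp
  next
    case False
    \<comment> \<open>Here \<open>x \<le> f i \<le> f t = x\<close>, so stage \<open>i\<close>
      already shows the value \<open>x\<close>.\<close>
    with t assms have "f t = f i" unfolding true_stage_def by (metis not_less order_antisym)
    with t assms(3) show ?thesis by metis
  qed
qed auto

section \<open>The theory of the true stages and its enumeration\<close>

definition true_stage_theory :: "(nat \<Rightarrow> nat) \<Rightarrow> fm set" where
  "true_stage_theory f =
     {p. sentence unary_language p \<and> (\<forall>k. true_stage f k \<longrightarrow> holds k p)}"

lemma proves_true_stage_theory:
  assumes "proves L (true_stage_theory f) p" "true_stage f k" shows "holds k p"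
  using assms by (auto intro: proves_sound simp: true_stage_theory_def)

lemma provable_codes_true_stage_theory:
  "provable_codes unary_language (true_stage_theory f) = code_fm ` true_stage_theory f"
proof -
  have "{p. sentence unary_language p \<and> proves unary_language (true_stage_theory f) p}
      = true_stage_theory f"
    using proves_true_stage_theory by (auto simp: true_stage_theory_def intro: proves.Axiom)
  then show ?thesis by (simp add: provable_codes_def)
qed

lemma consistent_true_stage_theory: "consistent L (true_stage_theory f)"
proof -
  obtain k where "true_stage f k" using true_stage_ge by blast
  then have "holds k Falsum" if "proves L (true_stage_theory f) Falsum"
    by (rule proves_true_stage_theory[OF that])
  then show ?thesis by (auto simp: consistent_def)
qed

lemma code_true_stage_theory_iff:
  "c \<in> code_fm ` true_stage_theory f \<longleftrightarrow>
    fm_rank c = 1 \<and> (\<forall>k. true_stage f k \<longrightarrow> holds_code k c)"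
proof
  assume "c \<in> code_fm ` true_stage_theory f"
  then obtain p where p: "p \<in> true_stage_theory f" and c: "c = code_fm p" by blast
  have "fm_rank c = 1"
    unfolding fm_rank_eq_1_iff using p c by (auto simp: true_stage_theory_def)
  moreover have "\<forall>k. true_stage f k \<longrightarrow> holds_code k c"
    using p unfolding c holds_code_iff true_stage_theory_def by blast
  ultimately show "fm_rank c = 1 \<and> (\<forall>k. true_stage f k \<longrightarrow> holds_code k c)" ..
next
  assume *: "fm_rank c = 1 \<and> (\<forall>k. true_stage f k \<longrightarrow> holds_code k c)"
  then obtain p where c: "code_fm p = c" and p: "sentence unary_language p"
    unfolding fm_rank_eq_1_iff by blast
  from * have "\<forall>k. true_stage f k \<longrightarrow> holds k p"
    unfolding c[symmetric] holds_code_iff by blast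
  with p have "p \<in> true_stage_theory f" by (simp add: true_stage_theory_def)
  then show "c \<in> code_fm ` true_stage_theory f" unfolding c[symmetric] by (rule imageI)
qed

text \<open>All models of index above \<open>c\<close> agree on the sentence with code
  \<open>c\<close>, and some true stage lies above \<open>c\<close>. One test at
  \<open>Suc c\<close> therefore replaces all large stages.\<close>

lemma code_true_stage_theory_iff_bounded:
  "c \<in> code_fm ` true_stage_theory f \<longleftrightarrow>
    fm_rank c = 1 \<and> holds_code (Suc c) c \<and> (\<forall>k\<le>c. true_stage f k \<longrightarrow> holds_code k c)"
proof (cases "fm_rank c = 1")
  case True
  then obtain p where p: "code_fm p = c" unfolding fm_rank_eq_1_iff by blast
  have large: "holds_code k c \<longleftrightarrow> holds_code (Suc c) c" if "c < k" for k
    using holds_above_code[of p k "Suc c"] that by (simp add: p flip: holds_code_iff)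
  obtain i where "c < i" "true_stage f i"
    using true_stage_ge[of "Suc c" f] by (auto simp: Suc_le_eq)
  then have "holds_code (Suc c) c" if "\<forall>k. true_stage f k \<longrightarrow> holds_code k c"
    using that large by blast
  moreover have "holds_code k c"
    if "holds_code (Suc c) c" "\<forall>k\<le>c. true_stage f k \<longrightarrow> holds_code k c" "true_stage f k" for k
    using that large[of k] by (cases "k \<le> c") auto
  ultimately show ?thesis
    unfolding code_true_stage_theory_iff by blast
qed (simp add: code_true_stage_theory_iff)

lemma uniform_bound:
  assumes "\<And>k. k \<le> (c::nat) \<Longrightarrow> Q k \<Longrightarrow> \<exists>s. R k s"
  shows "\<exists>t::nat. \<forall>k\<le>c. Q k \<longrightarrow> (\<exists>s\<le>t. R k s)"
proof -
  obtain g where g: "\<And>k. k \<le> c \<Longrightarrow> Q k \<Longrightarrow> R k (g k)" using assms by metis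
  then show ?thesis by (intro exI[of _ "\<Sum>k\<le>c. g k"]) (meson atMost_iff finite_atMost member_le_sum zero_le)
qed

text \<open>That a stage is not true is witnessed by a later smaller value. Pulling these witnesses
  out of the bounded quantifier by a common bound \<open>t\<close> gives an existential form with
  decidable matrix.\<close>

lemma code_true_stage_theory_ex:
  "c \<in> code_fm ` true_stage_theory f \<longleftrightarrow>
    (\<exists>t. fm_rank c = 1 \<and> holds_code (Suc c) c \<and>
      (\<forall>k\<le>c. \<not> holds_code k c \<longrightarrow> (\<exists>s\<le>t. k < s \<and> f s < f k)))"
proof -
  have "(\<forall>k\<le>c. true_stage f k \<longrightarrow> holds_code k c) \<longleftrightarrow>
      (\<exists>t. \<forall>k\<le>c. \<not> holds_code k c \<longrightarrow> (\<exists>s\<le>t. k < s \<and> f s < f k))"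
    using uniform_bound[of c "\<lambda>k. \<not> holds_code k c" "\<lambda>k s. k < s \<and> f s < f k"]
    unfolding true_stage_def by (meson not_less)
  then show ?thesis unfolding code_true_stage_theory_iff_bounded by simp
qed

lemma dec_in_stage_predicate:
  assumes f: "rec_in {} f" and c: "rec_in {} c" and t: "rec_in {} t"
  shows "dec_in {} (\<lambda>z. fm_rank (c z) = 1 \<and> holds_code (Suc (c z)) (c z) \<and>
    (\<forall>k\<le>c z. \<not> holds_code k (c z) \<longrightarrow> (\<exists>s\<le>t z. k < s \<and> f s < f k)))"
  by (intro rec_intros rec_in_fm_rank dec_in_holds_code c t
      rec_in_comp[OF f] rec_in_comp[OF c] rec_in_comp[OF t])

lemma re_code_true_stage_theory:
  assumes "rec_in {} f" shows "re_set (code_fm ` true_stage_theory f)"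
proof (rule smn_ex)
  fix j :: "nat \<Rightarrow> nat"
  assume "\<And>n. W (j n) = {c. \<exists>t. fm_rank c = 1 \<and> holds_code (Suc c) c \<and>
      (\<forall>k\<le>c. \<not> holds_code k c \<longrightarrow> (\<exists>s\<le>t. k < s \<and> f s < f k))}"
  \<comment> \<open>The parameter of the index function is a dummy; any value serves.\<close>
  then have "W (j 0) = code_fm ` true_stage_theory f"
    unfolding code_true_stage_theory_ex[symmetric] by simp
  then show ?thesis unfolding re_set_def by metis
qed (intro dec_in_stage_predicate assms rec_intros)

section \<open>Turing degree of the theory\<close>

lemma oracle_dec_in: "dec_in A (\<lambda>x. x \<in> A)"
  unfolding dec_in_def rec_in_def by (blast intro: runs.Query)

text \<open>A many-one reduction: \<open>W (j n)\<close> is everything or empty according to whether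
  \<open>n\<close> belongs to the theory, so \<open>j n\<close> lies in its own domain exactly in
  the first case.\<close>

lemma true_stage_theory_le_jump:
  assumes "rec_in {} f" shows "turing_le (code_fm ` true_stage_theory f) (jump {})"
proof (rule smn_ex)
  fix j :: "nat \<Rightarrow> nat"
  assume j: "rec_in {} j"
    and W: "\<And>n. W (j n) = {_::nat. \<exists>t. fm_rank n = 1 \<and> holds_code (Suc n) n \<and>
      (\<forall>k\<le>n. \<not> holds_code k n \<longrightarrow> (\<exists>s\<le>t. k < s \<and> f s < f k))}"
  have "n \<in> code_fm ` true_stage_theory f \<longleftrightarrow> j n \<in> jump {}" for n
    unfolding code_true_stage_theory_ex jump_def by (simp add: W)
  moreover have "dec_in (jump {}) (\<lambda>n. j n \<in> jump {})"
    by (rule dec_in_comp[OF oracle_dec_in rec_in_of_empty[OF j]])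
  ultimately show ?thesis unfolding turing_le_iff by simp
qed (intro dec_in_stage_predicate assms rec_intros)

text \<open>The sentence \<open>?\<theta> s\<close> fails only in the model of index
  \<open>s\<close>, so the theory omits it exactly when \<open>s\<close> is true.\<close>

lemma true_stage_dec_in_theory: "dec_in (code_fm ` true_stage_theory f) (true_stage f)"
proof -
  let ?\<theta> = "\<lambda>s. All (Rel s [Var 0])"
  have "sentence unary_language (?\<theta> s)" for s
    by (simp add: sentence_def unary_language_def)
  then have "fm_rank (code_fm (?\<theta> s)) = 1" for s
    unfolding fm_rank_eq_1_iff by blast
  then have "code_fm (?\<theta> s) \<in> code_fm ` true_stage_theory f \<longleftrightarrow> \<not> true_stage f s" for s
    unfolding code_true_stage_theory_iff holds_code_iff by auto
  moreover have "rec_in (code_fm ` true_stage_theory f) (\<lambda>s. code_fm (?\<theta> s))"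
    unfolding code_fm.simps by (intro rec_intros)
  then have "dec_in (code_fm ` true_stage_theory f)
      (\<lambda>s. \<not> code_fm (?\<theta> s) \<in> code_fm ` true_stage_theory f)"
    by (rule dec_in_not[OF dec_in_comp[OF oracle_dec_in]])
  ultimately show ?thesis by simp
qed

text \<open>With the theory as oracle, find a true stage of value at least \<open>x\<close>;
  membership of \<open>x\<close> in the range is then settled by a search up to that stage.\<close>

lemma range_le_true_stage_theory:
  assumes f: "rec_in {} f" and "inj f"
  shows "turing_le (range f) (code_fm ` true_stage_theory f)"
proof -
  let ?A = "code_fm ` true_stage_theory f"
  let ?s = "\<lambda>x. LEAST s. true_stage f s \<and> x \<le> f s"
  have fA: "rec_in ?A f" using f by (rule rec_in_of_empty)
  have s: "true_stage f (?s x) \<and> x \<le> f (?s x)" for x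
    using LeastI_ex[OF true_stage_ge_value[OF \<open>inj f\<close>]] .
  have "rec_in ?A ?s"
    by (rule rec_in_Least)
      (intro rec_intros dec_in_comp[OF true_stage_dec_in_theory] rec_in_comp[OF fA],
       rule true_stage_ge_value[OF \<open>inj f\<close>])
  then have "dec_in ?A (\<lambda>x. \<exists>t\<le>?s x. f t = x)"
    by (intro rec_intros rec_in_comp[OF fA])
  moreover have "x \<in> range f \<longleftrightarrow> (\<exists>t\<le>?s x. f t = x)" for x
    using range_bounded_search s by blast
  ultimately show ?thesis unfolding turing_le_iff by simp
qed

text \<open>
  Let \<open>i\<close> be a true stage and let \<open>W\<close> consist of the non-sentences and of the sentences refuted in
  the model of a true stage \<open>k \<le> i\<close> or in all models of large index. A productive function sends an
  index of \<open>W\<close> to an unprovable sentence outside \<open>W\<close>, which must be refuted at a true stage above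
  \<open>i\<close>. A predicate occurring in the sentence has an index below the code of the sentence, so this
  bounds the next true stage recursively.
\<close>

lemma true_stage_theory_not_creative:
  assumes f: "rec_in {} f" and "inj f" and not_recursive: "\<not> dec_in {} (\<lambda>x. x \<in> range f)"
  shows "\<not> creative (code_fm ` true_stage_theory f)"
proof
  let ?A = "code_fm ` true_stage_theory f"
  let ?V = "\<lambda>i c. fm_rank c \<noteq> 1 \<or> \<not> holds_code (Suc c) c \<or>
    (\<exists>k\<le>i. (\<forall>s\<le>i. k < s \<longrightarrow> f k \<le> f s) \<and> \<not> holds_code k c)"
  assume "creative ?A"
  then obtain h where h: "rec_in {} h" and prod: "\<And>e. W e \<subseteq> - ?A \<Longrightarrow> h e \<in> - ?A - W e"
    unfolding creative_def productive_def recursive_fun_iff by blast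
  have "dec_in {} (\<lambda>z. ?V (pfst (pfst z)) (psnd (pfst z)))"
    by (intro rec_intros rec_in_fm_rank dec_in_holds_code rec_in_comp[OF f])
  \<comment> \<open>The search variable \<open>t\<close> is a dummy, since \<open>?V\<close> is
    decidable.\<close>
  then obtain j where j: "rec_in {} j" and "\<And>i. W (j i) = {c. \<exists>t::nat. ?V i c}"
    by (rule smn_ex[where P = "\<lambda>i c t. ?V i c"]) (rule that)
  then have Wj: "W (j i) = {c. ?V i c}" for i by simp
  have next_stage: "\<exists>k. true_stage f k \<and> k \<le> h (j i) \<and> f i < f k" if i: "true_stage f i" for i
  proof -
    have "\<not> ?V i c" if "c \<in> ?A" for c
    proof -
      have "holds_code k c" if "k \<le> i" "\<forall>s\<le>i. k < s \<longrightarrow> f k \<le> f s" for k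
        using that true_stage_iff_upto[OF i] \<open>c \<in> ?A\<close> code_true_stage_theory_iff by blast
      then show ?thesis using that code_true_stage_theory_iff_bounded[of c f] by blast
    qed
    then have "W (j i) \<subseteq> - ?A" unfolding Wj by blast
    from prod[OF this] have "h (j i) \<notin> ?A" and nV: "\<not> ?V i (h (j i))" unfolding Wj by auto
    then obtain k where k: "k \<le> h (j i)" "true_stage f k" "\<not> holds_code k (h (j i))"
      unfolding code_true_stage_theory_iff_bounded by auto
    \<comment> \<open>If \<open>k \<le> i\<close>, then \<open>k\<close> would pass the test up to
      \<open>i\<close> and put the sentence into \<open>?V i\<close>.\<close>
    with nV true_stage_iff_upto[OF i, of k] have "i < k" by (meson not_less)
    with i \<open>inj f\<close> have "f i < f k"
      unfolding true_stage_def by (metis injD less_irrefl order_neq_le_trans)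
    with k show ?thesis by blast
  qed
  obtain i0 where i0: "true_stage f i0" using true_stage_ge by blast
  \<comment> \<open>Which stage up to the previous bound is the true one is unknown, so the bounds
    from all of them are added; the sum dominates each.\<close>
  define b where "b = rec_nat i0 (\<lambda>_ y. \<Sum>i\<le>y. h (j i))"
  \<comment> \<open>Each move to the next true stage strictly raises the value, so \<open>n\<close>
    moves reach the value \<open>n\<close>.\<close>
  have b: "\<exists>i\<le>b n. true_stage f i \<and> n \<le> f i" for n
  proof (induction n)
    case 0
    show ?case using i0 by (auto simp: b_def)
  next
    case (Suc n)
    then obtain i where i: "i \<le> b n" "true_stage f i" "n \<le> f i" by blast
    from next_stage[OF i(2)] obtain k where "true_stage f k" "k \<le> h (j i)" "f i < f k" by blast
    moreover have "h (j i) \<le> b (Suc n)"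
      unfolding b_def using i(1) by (auto intro!: member_le_sum simp: b_def)
    ultimately show ?case using i(3) by (intro exI[of _ k]) simp
  qed
  have "rec_in {} (\<lambda>x. b x)"
    unfolding b_def by (intro rec_intros rec_in_comp[OF h] rec_in_comp[OF j])
  then have "dec_in {} (\<lambda>x. \<exists>t\<le>b x. f t = x)"
    by (intro rec_intros rec_in_comp[OF f])
  moreover have "x \<in> range f \<longleftrightarrow> (\<exists>t\<le>b x. f t = x)" for x
    using b[of x] range_bounded_search[of f _ x] by blast
  ultimately show False using not_recursive by simp
qed

section \<open>An injective enumeration of the jump\<close>

text \<open>Each element of the jump is listed once, doubled, at its first halting time; all other
  arguments get distinct odd values, which keeps the function total and injective.\<close>

definition jump_enum :: "nat \<Rightarrow> nat" where
  "jump_enum z = (if halts_within (pfst z) (psnd z) \<and> (\<forall>t<psnd z. \<not> halts_within (pfst z) t)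
     then pfst z + pfst z else Suc (z + z))"

lemma rec_in_jump_enum: "rec_in A jump_enum"
  unfolding jump_enum_def[abs_def] by (intro rec_intros dec_in_halts_within)

text \<open>Parity separates the two clauses; an even value determines \<open>pfst z\<close>, and
  the first halting time is unique.\<close>

lemma inj_jump_enum: "inj jump_enum"
proof (rule injI)
  fix y z
  assume eq: "jump_enum y = jump_enum z"
  let ?H = "\<lambda>w. halts_within (pfst w) (psnd w) \<and> (\<forall>t<psnd w. \<not> halts_within (pfst w) t)"
  have H: "jump_enum w = pfst w + pfst w" if "?H w" for w
    using that by (simp add: jump_enum_def)
  have nH: "jump_enum w = Suc (w + w)" if "\<not> ?H w" for w
    using that unfolding jump_enum_def by (rule if_not_P)
  show "y = z"
  proof (cases "?H y")
    case True
    have Hz: "?H z"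
    proof (rule ccontr)
      assume "\<not> ?H z"
      from nH[OF this] H[OF True] eq show False by presburger
    qed
    have "pfst y = pfst z" using H[OF True] H[OF Hz] eq by simp
    moreover have "psnd y = psnd z"
      using True Hz unfolding \<open>pfst y = pfst z\<close> by (meson linorder_neqE_nat)
    ultimately show ?thesis by (metis prod_encode_pfst_psnd)
  next
    case False
    have nHz: "\<not> ?H z"
    proof
      assume "?H z"
      from H[OF this] nH[OF False] eq show False by presburger
    qed
    show ?thesis using nH[OF False] nH[OF nHz] eq by simp
  qed
qed

lemma jump_iff_range: "x \<in> jump {} \<longleftrightarrow> x + x \<in> range jump_enum"
proof
  assume "x \<in> jump {}"
  then obtain t where "halts_within x t" "\<forall>s<t. \<not> halts_within x s"
    unfolding jump_iff by (metis exists_least_iff)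
  then have "jump_enum (prod_encode (x, t)) = x + x" by (simp add: jump_enum_def)
  then show "x + x \<in> range jump_enum" by (metis rangeI)
next
  assume "x + x \<in> range jump_enum"
  then obtain z where z: "x + x = jump_enum z" by auto
  then have "even (jump_enum z)" by (metis even_add)
  with z have "x = pfst z" "halts_within (pfst z) (psnd z)"
    by (auto simp: jump_enum_def split: if_splits)
  then show "x \<in> jump {}" unfolding jump_iff by blast
qed

lemma jump_le_range: "turing_le (jump {}) (range jump_enum)"
  unfolding turing_le_iff jump_iff_range
  by (rule dec_in_comp[OF oracle_dec_in]) (intro rec_intros)

theorem theorem7p5:
  "\<exists>(L :: language) (T :: fm set).
     re_theory L T \<and> consistent L T \<and> theory_degree L T = zero_jump \<and> \<not> creative_theory L T"
proof (intro exI conjI)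
  let ?T = "true_stage_theory jump_enum"
  show "re_theory unary_language ?T"
    using recursive_unary_language re_code_true_stage_theory[OF rec_in_jump_enum]
    by (auto simp: re_theory_def is_theory_def true_stage_theory_def)
  show "consistent unary_language ?T"
    by (rule consistent_true_stage_theory)
  show "theory_degree unary_language ?T = zero_jump"
    unfolding theory_degree_def zero_jump_def provable_codes_true_stage_theory
    \<comment> \<open>The cycle of reductions: the theory is below the jump, the jump below the
      range by doubling, and the range below the theory.\<close>
    by (intro turing_degree_eqI true_stage_theory_le_jump rec_in_jump_enum
        turing_le_trans[OF jump_le_range] range_le_true_stage_theory inj_jump_enum)
  have "\<not> dec_in {} (\<lambda>x. x \<in> range jump_enum)"
  proof
    assume "dec_in {} (\<lambda>x. x \<in> range jump_enum)"
    from dec_in_comp[OF this rec_in_add[OF rec_in_id rec_in_id]] jump_not_recursive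
    show False by (simp add: jump_iff_range)
  qed
  then show "\<not> creative_theory unary_language ?T"
    unfolding creative_theory_def provable_codes_true_stage_theory
    by (intro true_stage_theory_not_creative rec_in_jump_enum inj_jump_enum)
qed

end
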